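(* For every $c\geq1$ the free Poisson distribution $\mathrm{m}_{c}$ is $\boxtimes$-2 divisible.
   Context: For $c>0$ the free Poisson (Marchenko–Pastur) distribution is $$\mathrm{m}_{c}(\mathrm{d}x)=\max(0,1-c)\,\delta_{0}(\mathrm{d}x)+\frac{1}{2\pi x}\sqrt{4c-(x-1-c)^{2}}\;1_{[(1-\sqrt{c})^{2},(1+\sqrt{c})^{2}]}(x)\mathrm{d}x.$$ $\mathcal{P}_+$ is the set of Borel probability measures supported in $\mathbb{R}_+=[0,\infty)$. For $\mu\in\mathcal{P}_+$, $\mu\ne\delta_0$, let $\Psi_\mu(z)=\int\frac{zx}{1-zx}\mu(\mathrm{d}x)$; it has an inverse $\chi_\mu$ on $\Psi_\mu(i\mathbb{C}^+)$ with values in the left half-plane $i\mathbb{C}^+$, and $S_\mu(z)=\chi_\mu(z)\frac{1+z}{z}$. For $\mu_1,\mu_2\in\mathcal{P}_+$, $\mu_1\boxtimes\mu_2$ is the measure in $\mathcal{P}_+$ with $S_{\mu_1\boxtimes\mu_2}=S_{\mu_1}S_{\mu_2}$ on a common domain (and $\delta_0$ if one factor is $\delta_0$); equivalently, the spectral distribution of $X^{1/2}YX^{1/2}$ for free positive $X,Y$ with distributions $\mu_1,\mu_2$. A measure $\sigma\in\mathcal{P}_+$ is $\boxtimes$-2 divisible if there exists $\overline{\sigma}\in\mathcal{P}_+$ with $\sigma=\overline{\sigma}\boxtimes\overline{\sigma}$. *)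

theory Defs
  imports "HOL-Probability.Probability"
begin

definition mp_density :: "real \<Rightarrow> real \<Rightarrow> real" where
  "mp_density c x =
     1 / (2 * pi * x) * sqrt (4 * c - (x - 1 - c)\<^sup>2) *
     indicator {(1 - sqrt c)\<^sup>2..(1 + sqrt c)\<^sup>2} x"

definition free_poisson :: "real \<Rightarrow> real measure" where
  "free_poisson c = measure_of UNIV (sets borel)
     (\<lambda>A. ennreal (max 0 (1 - c)) * emeasure (return borel 0) A
        + emeasure (density lborel (\<lambda>x. ennreal (mp_density c x))) A)"

(* The set function in the definition above is countably additive, so that measure_of
   does not collapse it to the zero measure. *)
lemma sets_free_poisson [simp, measurable_cong]: "sets (free_poisson c) = sets borel"
  unfolding free_poisson_def by (metis sets.sets_measure_of_eq space_borel)

lemma emeasure_free_poisson: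
  assumes "A \<in> sets borel"
  shows "emeasure (free_poisson c) A =
    ennreal (max 0 (1 - c)) * indicator A 0 +
    (\<integral>\<^sup>+x. ennreal (mp_density c x) * indicator A x \<partial>lborel)"
proof -
  let ?a = "ennreal (max 0 (1 - c))"
  let ?M = "return borel (0::real)"
  let ?N = "density lborel (\<lambda>x. ennreal (mp_density c x))"
  let ?mu = "\<lambda>A. ?a * emeasure ?M A + emeasure ?N A"
  have m: "(\<lambda>x. ennreal (mp_density c x)) \<in> borel_measurable lborel"
    unfolding mp_density_def by measurable
  have "countably_additive (sets borel) ?mu"
  proof (rule countably_additiveI)
    fix F :: "nat \<Rightarrow> real set"
    assume F: "range F \<subseteq> sets borel" "disjoint_family F" "(\<Union>i. F i) \<in> sets borel"
    have "(\<Sum>i. ?mu (F i)) = (\<Sum>i. ?a * emeasure ?M (F i)) + (\<Sum>i. emeasure ?N (F i))"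
      by (rule suminf_add[symmetric]) auto
    also have "\<dots> = ?mu (\<Union>i. F i)"
      using F suminf_emeasure[of F ?M] suminf_emeasure[of F ?N]
      by (simp del: emeasure_return)
    finally show "(\<Sum>i. ?mu (F i)) = ?mu (\<Union>i. F i)" .
  qed
  moreover have "sigma_algebra UNIV (sets (borel :: real measure))"
    by (metis sets.sigma_algebra_axioms space_borel)
  ultimately have "emeasure (free_poisson c) A = ?mu A"
    unfolding free_poisson_def using assms
    by (intro emeasure_measure_of_sigma) (auto simp: positive_def)
  then show ?thesis
    using assms m by (simp add: emeasure_density)
qed

definition pos_prob_measures :: "real measure set" where
  "pos_prob_measures = {\<mu>. real_distribution \<mu> \<and> (AE x in \<mu>. 0 \<le> x)}"

abbreviation delta0 :: "real measure" where
  "delta0 \<equiv> return borel 0"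

definition Psi :: "real measure \<Rightarrow> complex \<Rightarrow> complex" where
  "Psi \<mu> z = (LINT x|\<mu>. (z * complex_of_real x) / (1 - z * complex_of_real x))"

definition left_half_plane :: "complex set" where
  "left_half_plane = {z. Re z < 0}"

(* For mu in pos_prob_measures other than delta0, Psi mu is injective on left_half_plane;
   chi and S are only meaningful on Psi mu ` left_half_plane. *)
definition chi :: "real measure \<Rightarrow> complex \<Rightarrow> complex" where
  "chi \<mu> = inv_into left_half_plane (Psi \<mu>)"

definition S_transform :: "real measure \<Rightarrow> complex \<Rightarrow> complex" where
  "S_transform \<mu> z = chi \<mu> z * (1 + z) / z"

(* S sigma = S mu * S nu on a common domain: an open connected set on which all three
   S-transforms are defined. Requiring it to contain a left neighbourhood of 0 in the reals
   (each range Psi mu ` left_half_plane meets the reals in the interval from mu{0} - 1 to 0)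
   fixes the component of the intersection of the three ranges, so that sigma is
   determined by mu and nu. *)
definition S_multiplicative :: "real measure \<Rightarrow> real measure \<Rightarrow> real measure \<Rightarrow> bool" where
  "S_multiplicative \<mu> \<nu> \<sigma> \<longleftrightarrow>
     (\<exists>D. open D \<and> connected D \<and>
          D \<subseteq> Psi \<mu> ` left_half_plane \<inter> Psi \<nu> ` left_half_plane \<inter> Psi \<sigma> ` left_half_plane \<and>
          (\<exists>\<epsilon>>0. complex_of_real ` {-\<epsilon><..<0} \<subseteq> D) \<and>
          (\<forall>z\<in>D. S_transform \<sigma> z = S_transform \<mu> z * S_transform \<nu> z))"

definition free_mult_conv :: "real measure \<Rightarrow> real measure \<Rightarrow> real measure" (infixl "\<boxtimes>" 70) where
  "\<mu> \<boxtimes> \<nu> =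
     (if \<mu> = delta0 \<or> \<nu> = delta0 then delta0
      else (THE \<sigma>. \<sigma> \<in> pos_prob_measures \<and> S_multiplicative \<mu> \<nu> \<sigma>))"

definition free_mult_2_divisible :: "real measure \<Rightarrow> bool" where
  "free_mult_2_divisible \<sigma> \<longleftrightarrow>
     \<sigma> \<in> pos_prob_measures \<and> (\<exists>\<rho>\<in>pos_prob_measures. \<sigma> = \<rho> \<boxtimes> \<rho>)"

end

theory Submission
  imports Defs "HOL-Complex_Analysis.Complex_Analysis"
begin

text \<open>
  The S-transform of \<open>m\<^sub>c\<close> is \<open>1 / (c + z)\<close>, so a square root \<open>\<rho>\<close> must have S-transform
  \<open>1 / sqrt (c + z)\<close>; in terms of \<open>M(t) = \<integral> 1 / (1 + t x) \<rho>(dx)\<close> this is the equation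
  \<open>M (1 + t sqrt (c - 1 + M)) = 1\<close>. The measure \<open>\<rho>\<close> is obtained by solving this equation by the
  iteration \<open>M' = 1 / (1 + t sqrt (c - 1 + M))\<close>, extended to \<open>t = q\<^sup>2\<close> with \<open>q\<close> in the right half-plane.
  For \<open>c \<ge> 1\<close> the iteration preserves the condition \<open>\<bar>Arg (q M)\<bar> \<le> \<bar>Arg q\<bar>\<close>, so by the Herglotz
  theorem (Cauchy's formula plus Helly selection) each iterate is the transform of a measure; for
  real \<open>t > 0\<close> the iterates converge, because the logarithmic error is halved in each step, and the
  limit of the measures is the one sought. That \<open>\<rho> \<boxtimes> \<rho>\<close> is \<open>m\<^sub>c\<close> then follows from the explicit
  transform of \<open>m\<^sub>c\<close>, the injectivity of \<open>Psi\<close> on the left half-plane, the identity theorem, and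
  the fact that a measure on the half-line is determined by \<open>Psi\<close> on a real interval.
\<close>

section \<open>Measures on the half-line\<close>

text \<open>The equation for \<open>M\<close> comes from the S-transform: with
  \<open>z = Psi(-t) = M - 1\<close>, the inverse \<open>chi z = z / ((1 + z) sqrt (c + z))\<close>
  must equal \<open>- t\<close>, that is \<open>t M sqrt (c - 1 + M) = 1 - M\<close>. Squared, this
  is a cubic in \<open>M\<close>; the difficulty is not to solve it but to see that the branch with
  \<open>M = 1\<close> at \<open>t = 0\<close> is the transform of a positive measure. The iteration
  avoids following a root of the cubic through the complex plane. The substitution
  \<open>t = q^2\<close> turns the kernel into \<open>q / (1 + q^2 x) = 1 / (1 / q + q x)\<close>.
  Both \<open>1 / q\<close> and \<open>q x\<close> lie in the sector
  \<open>|Arg| <= |Arg q|\<close>, which is stable under sums and inverses; this is the origin of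
  the condition that the iteration preserves. The Herglotz representation is evaluated only at real
  points, so convergence on the positive axis suffices and no limit of holomorphic functions is
  taken. Since the convolution is a definite description, a measure with the right S-transform is
  not enough: the product must also be shown to be unique.\<close>

locale nonneg_distribution = real_distribution M for M :: "real measure" +
  assumes nonneg: "AE x in M. 0 \<le> x"

lemma nonneg_distribution_iff: "nonneg_distribution M \<longleftrightarrow> M \<in> pos_prob_measures"
  by (simp add: nonneg_distribution_def nonneg_distribution_axioms_def pos_prob_measures_def)

lemma Re_one_minus_mult_ge_1:
  assumes "Re z \<le> 0" "0 \<le> x"
  shows "1 \<le> Re (1 - z * complex_of_real x)"
  using assms by (simp add: mult_nonpos_nonneg)

lemma norm_inverse_one_minus_mult_le_1:
  assumes "Re z \<le> 0" "0 \<le> x"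
  shows "norm (1 / (1 - z * complex_of_real x)) \<le> 1"
proof -
  have *: "1 \<le> norm (1 - z * complex_of_real x)"
    using Re_one_minus_mult_ge_1[OF assms] complex_Re_le_cmod order_trans by blast
  then have "0 < norm (1 - z * complex_of_real x)" by linarith
  with * show ?thesis
    by (simp add: norm_divide)
qed

lemma one_minus_mult_nonzero:
  assumes "Re z \<le> 0" "0 \<le> x"
  shows "1 - z * complex_of_real x \<noteq> 0"
  using Re_one_minus_mult_ge_1[OF assms]
  by (metis not_one_le_zero zero_complex.simps(1))

text \<open>A bijection of the half-line onto \<open>[0, 1)\<close>. It turns an arbitrary measure
  into one with bounded moments, and these moments govern the Taylor expansion of \<open>Psi\<close>
  about \<open>- t\<close>.\<close>

definition ratio_map :: "real \<Rightarrow> real \<Rightarrow> real" where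
  "ratio_map t x = t * x / (1 + t * x)"

lemma ratio_map_measurable [measurable]: "ratio_map t \<in> borel_measurable borel"
  unfolding ratio_map_def by measurable

lemma ratio_map_bounds:
  assumes "0 < t" "0 \<le> x"
  shows "0 \<le> ratio_map t x" "ratio_map t x < 1"
proof -
  have "0 \<le> t * x" using assms by simp
  then show "0 \<le> ratio_map t x" "ratio_map t x < 1"
    by (auto simp: ratio_map_def divide_simps)
qed

lemma one_minus_ratio_map:
  assumes "0 < t" "0 \<le> x"
  shows "1 - ratio_map t x = 1 / (1 + t * x)"
proof -
  have "0 \<le> t * x" using assms by simp
  then show ?thesis by (simp add: ratio_map_def divide_simps)
qed

context nonneg_distribution
begin

lemma integrable_Psi_kernel:
  assumes "Re z \<le> 0"
  shows "integrable M (\<lambda>x. 1 / (1 - z * complex_of_real x))"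
proof (rule integrable_const_bound)
  show "AE x in M. norm (1 / (1 - z * complex_of_real x)) \<le> 1"
    using nonneg by eventually_elim (use assms norm_inverse_one_minus_mult_le_1 in blast)
qed measurable

lemma Psi_eq:
  assumes "Re z \<le> 0"
  shows "Psi M z = (LINT x|M. 1 / (1 - z * complex_of_real x)) - 1"
proof -
  have "Psi M z = (LINT x|M. 1 / (1 - z * complex_of_real x) - 1)"
    unfolding Psi_def
  proof (rule integral_cong_AE)
    show "AE x in M. z * complex_of_real x / (1 - z * complex_of_real x)
            = 1 / (1 - z * complex_of_real x) - 1"
      using nonneg
      by eventually_elim (use one_minus_mult_nonzero[OF assms] in \<open>simp add: field_simps\<close>)
  qed measurable
  also have "\<dots> = (LINT x|M. 1 / (1 - z * complex_of_real x)) - 1"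
    using integrable_Psi_kernel[OF assms] prob_space by simp
  finally show ?thesis .
qed

lemma integrable_ratio_power:
  assumes "0 < t"
  shows "integrable M (\<lambda>x. ratio_map t x ^ k)"
proof (rule integrable_const_bound)
  show "AE x in M. norm (ratio_map t x ^ k) \<le> 1"
    using nonneg
  proof eventually_elim
    case (elim x)
    show ?case
      using ratio_map_bounds[OF assms elim] by (simp add: power_le_one power_abs)
  qed
qed measurable

text \<open>With \<open>g = ratio_map t x\<close> the kernel at \<open>- t (1 + u)\<close> is
  \<open>(1 - g) / (1 + u g)\<close>, a geometric series in \<open>- u g\<close>. Since
  \<open>0 <= g < 1\<close>, the terms are bounded by \<open>|u|^k\<close>, so sum and integral can
  be exchanged.\<close>

lemma Psi_power_series:
  assumes t: "0 < t" and u: "norm u < 1"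
  shows "(\<lambda>k. complex_of_real (LINT x|M. (1 - ratio_map t x) * ratio_map t x ^ k) * (- u) ^ k)
           sums (Psi M (- (of_real t * (1 + u))) + 1)"
proof -
  let ?z = "- (of_real t * (1 + u))"
  let ?f = "\<lambda>k x. complex_of_real ((1 - ratio_map t x) * ratio_map t x ^ k) * (- u) ^ k"
  have "\<bar>Re u\<bar> < 1" using u abs_Re_le_cmod le_less_trans by blast
  then have z: "Re ?z \<le> 0" using t by (simp add: mult_nonneg_nonneg)
  have int: "integrable M (\<lambda>x. (1 - ratio_map t x) * ratio_map t x ^ k)" for k
    using integrable_ratio_power[OF t, of k] integrable_ratio_power[OF t, of "Suc k"]
    by (simp add: algebra_simps)
  have intf: "integrable M (?f k)" for k
    by (intro integrable_mult_left integrable_of_real int)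
  have bound: "norm (?f k x) \<le> norm u ^ k" if "0 \<le> x" for k x
  proof -
    have "\<bar>(1 - ratio_map t x) * ratio_map t x ^ k\<bar> \<le> 1 * 1"
      unfolding abs_mult using ratio_map_bounds[OF t that]
      by (intro mult_mono) (auto simp: power_abs intro: power_le_one)
    then show ?thesis
      by (simp add: norm_mult norm_power mult_left_le_one_le del: of_real_mult of_real_diff of_real_power)
  qed
  have geom: "(\<lambda>k. ?f k x) sums (1 / (1 - ?z * complex_of_real x))" if x: "0 \<le> x" for x
  proof -
    define g where "g = complex_of_real (ratio_map t x)"
    have "norm (- u * g) < 1"
      using ratio_map_bounds[OF t x] u
      by (simp add: g_def norm_mult mult_le_one) (smt (verit) mult_left_le norm_ge_zero)
    from sums_mult[OF geometric_sums[OF this], of "1 - g"]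
    have "(\<lambda>k. ?f k x) sums ((1 - g) * (1 / (1 + u * g)))"
      by (simp only: g_def of_real_mult of_real_diff of_real_power of_real_1 power_mult_distrib mult_ac
          minus_mult_left) simp
    moreover have "(1 - g) * (1 / (1 + u * g)) = 1 / (1 - ?z * complex_of_real x)"
    proof -
      have tx: "0 \<le> t * x" using t x by simp
      then have nz: "1 + complex_of_real t * of_real x \<noteq> 0"
        by (metis add_nonneg_eq_0_iff of_real_1 of_real_add of_real_eq_0_iff of_real_mult zero_le_one zero_neq_one)
      have g: "g = of_real t * of_real x / (1 + of_real t * of_real x)"
        by (simp add: g_def ratio_map_def)
      have "1 - g = 1 / (1 + of_real t * of_real x)"
        using nz by (simp add: g divide_simps)
      moreover have "1 + u * g = (1 - ?z * of_real x) / (1 + of_real t * of_real x)"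
        using nz by (simp add: g divide_simps) (simp add: algebra_simps)
      ultimately show ?thesis using nz by simp
    qed
    ultimately show ?thesis by simp
  qed
  have summ: "summable (\<lambda>k. norm (?f k x))" if "0 \<le> x" for x
    by (rule summable_comparison_test'[OF summable_geometric[of "norm u"]]) (use u bound[OF that] in auto)
  have "(\<lambda>k. LINT x|M. ?f k x) sums (LINT x|M. (\<Sum>k. ?f k x))"
  proof (rule sums_integral)
    show "AE x in M. summable (\<lambda>k. norm (?f k x))"
      using nonneg by eventually_elim (rule summ)
    show "summable (\<lambda>k. LINT x|M. norm (?f k x))"
    proof (rule summable_comparison_test'[OF summable_geometric[of "norm u"]])
      fix k :: nat
      have "(LINT x|M. norm (?f k x)) \<le> (LINT x|M. norm u ^ k)"
        using nonneg bound
        by (intro integral_mono_AE integrable_norm intf) (auto elim!: eventually_mono)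
      then show "norm (LINT x|M. norm (?f k x)) \<le> norm u ^ k"
        using prob_space by simp
    qed (use u in simp)
  qed (rule intf)
  also have "(LINT x|M. (\<Sum>k. ?f k x)) = (LINT x|M. 1 / (1 - ?z * complex_of_real x))"
  proof (rule integral_cong_AE)
    show "AE x in M. (\<Sum>k. ?f k x) = 1 / (1 - ?z * complex_of_real x)"
      using nonneg by eventually_elim (use geom sums_unique in fastforce)
  qed measurable
  also have "\<dots> = Psi M ?z + 1"
    using Psi_eq[OF z] by simp
  also have "(\<lambda>k. LINT x|M. ?f k x)
      = (\<lambda>k. of_real (LINT x|M. (1 - ratio_map t x) * ratio_map t x ^ k) * (- u) ^ k)"
    by (simp only: integral_mult_left_zero integral_complex_of_real)
  finally show ?thesis .
qed

(* The left half-plane is the union of the discs of radius t about -t. *)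
lemma Psi_holomorphic: "Psi M holomorphic_on left_half_plane"
proof (rule holomorphic_onI)
  fix z assume "z \<in> left_half_plane"
  then have z: "Re z < 0" by (simp add: left_half_plane_def)
  \<comment> \<open>The disc contains \<open>z\<close> iff \<open>t > |z|^2 / (- 2 Re z)\<close>;
    twice this bound is taken, so that \<open>|z + t|^2 = t^2 - |z|^2\<close>.\<close>
  define t where "t = (norm z)\<^sup>2 / (- Re z)"
  have nz: "0 < norm z" using z by auto
  then have t: "0 < t" using z by (simp add: t_def del: divide_minus_right)
  have in_ball: "z \<in> ball (- of_real t) t"
  proof -
    have "(norm (z + of_real t))\<^sup>2 = (norm z)\<^sup>2 + 2 * t * Re z + t\<^sup>2"
      by (simp add: cmod_power2) (simp add: power2_eq_square algebra_simps)
    also have "2 * t * Re z = - 2 * (norm z)\<^sup>2"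
      using z by (simp add: t_def)
    finally have "(norm (z + of_real t))\<^sup>2 < t\<^sup>2" using nz by simp
    then have "norm (z + of_real t) < t" using t power2_less_imp_less by force
    then show ?thesis by (simp add: dist_norm norm_minus_commute)
  qed
  define a where "a k = complex_of_real (LINT x|M. (1 - ratio_map t x) * ratio_map t x ^ k)
      * (1 / of_real t) ^ k" for k
  have "(\<lambda>w. Psi M w + 1) holomorphic_on ball (- of_real t) t"
  proof (rule power_series_holomorphic)
    fix w assume "w \<in> ball (- complex_of_real t) t"
    then have w: "norm (w + of_real t) < t"
      by (simp add: dist_norm) (metis add.commute norm_minus_commute diff_minus_eq_add uminus_add_conv_diff)
    define u where "u = - (w + of_real t) / of_real t"
    have "norm u < 1" using w t by (simp only: u_def norm_divide norm_minus_cancel) simp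
    moreover have "- (of_real t * (1 + u)) = w" "- u = (w + of_real t) / of_real t"
      using t by (auto simp: u_def divide_simps)
    ultimately have "(\<lambda>k. complex_of_real (LINT x|M. (1 - ratio_map t x) * ratio_map t x ^ k)
        * ((w + of_real t) / of_real t) ^ k) sums (Psi M w + 1)"
      using Psi_power_series[OF t, of u] by metis
    then show "(\<lambda>k. a k * (w - - complex_of_real t) ^ k) sums (Psi M w + 1)"
      by (simp only: a_def power_divide power_one mult.assoc diff_minus_eq_add times_divide_eq_left mult_1)
  qed
  then have "(\<lambda>w. (Psi M w + 1) - 1) holomorphic_on ball (- of_real t) t"
    by (rule holomorphic_on_diff[OF _ holomorphic_on_const])
  then have "Psi M holomorphic_on ball (- of_real t) t"
    by simp
  then have "Psi M field_differentiable at z"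
    using in_ball holomorphic_on_imp_differentiable_at open_ball by blast
  then show "Psi M field_differentiable at z within left_half_plane"
    by (rule field_differentiable_at_within)
qed

end

section \<open>Uniqueness: a measure on the half-line is determined by \<open>Psi\<close> on a real
  interval\<close>

lemma power_series_eq_0:
  fixes a :: "nat \<Rightarrow> complex"
  assumes sums: "\<And>u. norm u < 1 \<Longrightarrow> (\<lambda>k. a k * u ^ k) sums f u"
    and d: "0 < d" and f: "\<And>u. \<bar>u\<bar> < d \<Longrightarrow> f (complex_of_real u) = 0"
  shows "a k = 0"
proof (rule ccontr)
  assume k: "a k \<noteq> 0"
  have f0: "f 0 = 0" using f[of 0] d by simp
  have "a 0 = 0"
    using sums_unique2[OF powser_sums_zero[of a] sums[of 0]] f0 by simp
  then have "0 < k" using k by (cases k) auto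
  have "(\<lambda>n. a n * (u - 0) ^ n) sums f u" if "norm (u - 0) < 1" for u
    using sums[of u] that by simp
  from powser_0_nonzero[OF zero_less_one this f0 k \<open>0 < k\<close>]
  obtain s where s: "0 < s" "\<And>z. z \<in> cball 0 s - {0} \<Longrightarrow> f z \<noteq> 0" by blast
  define e where "e = min s (d / 2)"
  have "0 < e" "e \<le> s" "e < d" using s d by (auto simp: e_def)
  then show False
    using s(2)[of "of_real e"] f[of e] by simp
qed

text \<open>The interval determines the Taylor coefficients of \<open>Psi\<close> at its midpoint.
  These are differences of consecutive moments of the image under \<open>ratio_map t\<close>, so all
  moments agree by telescoping from the total mass. The image measure is bounded, hence its moments
  determine its characteristic function.\<close>

lemma nonneg_distribution_eqI:
  assumes "nonneg_distribution M" "nonneg_distribution N"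
    and t12: "0 < t1" "t1 < t2"
    and eq: "\<And>t. t1 < t \<Longrightarrow> t < t2 \<Longrightarrow> Psi M (- complex_of_real t) = Psi N (- complex_of_real t)"
  shows "M = N"
proof -
  interpret M: nonneg_distribution M by fact
  interpret N: nonneg_distribution N by fact
  define t where "t = (t1 + t2) / 2"
  \<comment> \<open>The radius for which \<open>t (1 - u)\<close> stays between \<open>t1\<close>
    and \<open>t2\<close>: \<open>t d\<close> is half the length of the interval.\<close>
  define d where "d = (t2 - t1) / (2 * t)"
  have t: "0 < t" and d: "0 < d" using t12 by (auto simp: t_def d_def)
  define aM where "aM k = (LINT x|M. (1 - ratio_map t x) * ratio_map t x ^ k)" for k
  define aN where "aN k = (LINT x|N. (1 - ratio_map t x) * ratio_map t x ^ k)" for k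
  let ?f = "\<lambda>u. Psi M (- (of_real t * (1 - u))) - Psi N (- (of_real t * (1 - u)))"
  have a: "aM k = aN k" for k
  proof -
    have "complex_of_real (aM k - aN k) = 0"
    proof (rule power_series_eq_0[where f = ?f and d = d])
      fix u :: complex assume "norm u < 1"
      then have "norm (- u) < 1" by simp
      from sums_diff[OF M.Psi_power_series[OF t this, folded aM_def] N.Psi_power_series[OF t this, folded aN_def]]
      show "(\<lambda>k. complex_of_real (aM k - aN k) * u ^ k) sums ?f u"
        by (simp add: left_diff_distrib)
    next
      fix u :: real assume u: "\<bar>u\<bar> < d"
      then have "\<bar>t * u\<bar> < (t2 - t1) / 2"
        using t by (simp add: d_def abs_mult field_simps)
      moreover have "t * (1 - u) = t - t * u" by (simp add: algebra_simps)
      moreover have "t1 = t - (t2 - t1) / 2" "t2 = t + (t2 - t1) / 2" by (simp_all add: t_def field_simps)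
      ultimately have "t1 < t * (1 - u)" "t * (1 - u) < t2" by linarith+
      from eq[OF this] show "?f (of_real u) = 0" by simp
    qed (rule d)
    then show ?thesis by simp
  qed
  define mM where "mM k = (LINT x|M. ratio_map t x ^ k)" for k
  define mN where "mN k = (LINT x|N. ratio_map t x ^ k)" for k
  have "mM k = mN k" for k
  proof (induction k)
    case 0
    show ?case using M.prob_space N.prob_space by (simp add: mM_def mN_def)
  next
    case (Suc k)
    have split: "(1 - ratio_map t x) * ratio_map t x ^ k = ratio_map t x ^ k - ratio_map t x ^ Suc k" for x
      by (simp add: algebra_simps)
    have "aM k = mM k - mM (Suc k)"
      unfolding aM_def mM_def split using M.integrable_ratio_power[OF t]
      by (intro Bochner_Integration.integral_diff)
    moreover have "aN k = mN k - mN (Suc k)"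
      unfolding aN_def mN_def split using N.integrable_ratio_power[OF t]
      by (intro Bochner_Integration.integral_diff)
    ultimately show ?case using Suc a[of k] by simp
  qed
  then have mom: "mM = mN" by auto
  \<comment> \<open>The exponential series is integrated term by term; the powers of
    \<open>ratio_map t x\<close> are at most 1, so the exponential series of \<open>|s|\<close>
    dominates.\<close>
  have char: "(\<lambda>k. ((\<i> * of_real s) ^ k / fact k) * of_real (LINT x|P. ratio_map t x ^ k))
      sums char (distr P borel (ratio_map t)) s" if "nonneg_distribution P" for P s
  proof -
    interpret P: nonneg_distribution P by fact
    let ?g = "\<lambda>k x. ((\<i> * of_real s) ^ k / fact k) * complex_of_real (ratio_map t x ^ k)"
    have exp: "(\<lambda>k. ?g k x) sums iexp (s * ratio_map t x)" for x
      using exp_converges[of "\<i> * of_real (s * ratio_map t x)"]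
      by (simp add: scaleR_conv_of_real power_mult_distrib mult_ac divide_inverse)
    have bound: "norm (?g k x) \<le> \<bar>s\<bar> ^ k / fact k" if "0 \<le> x" for k x
    proof -
      have "\<bar>ratio_map t x ^ k\<bar> \<le> 1"
        using ratio_map_bounds[OF t that] by (simp add: power_abs power_le_one)
      then have "\<bar>s\<bar> ^ k / fact k * \<bar>ratio_map t x ^ k\<bar> \<le> \<bar>s\<bar> ^ k / fact k"
        by (intro mult_left_le) auto
      then show ?thesis by (simp add: norm_mult norm_divide norm_power power_abs)
    qed
    have summ: "summable (\<lambda>k. \<bar>s\<bar> ^ k / fact k)"
      using summable_exp[of "\<bar>s\<bar>"] by (simp add: divide_inverse mult.commute)
    have int: "integrable P (?g k)" for k
      by (intro integrable_mult_right integrable_of_real P.integrable_ratio_power t)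
    have "(\<lambda>k. LINT x|P. ?g k x) sums (LINT x|P. (\<Sum>k. ?g k x))"
    proof (rule sums_integral)
      show "AE x in P. summable (\<lambda>k. norm (?g k x))"
        using P.nonneg
      proof eventually_elim
        case (elim x)
        show ?case
          by (rule summable_comparison_test'[OF summ]) (use bound[OF elim] in simp)
      qed
      show "summable (\<lambda>k. LINT x|P. norm (?g k x))"
      proof (rule summable_comparison_test'[OF summ])
        fix k :: nat
        have "(LINT x|P. norm (?g k x)) \<le> (LINT x|P. \<bar>s\<bar> ^ k / fact k)"
          using P.nonneg bound
          by (intro integral_mono_AE integrable_norm int) (auto elim!: eventually_mono)
        then show "norm (LINT x|P. norm (?g k x)) \<le> \<bar>s\<bar> ^ k / fact k"
          using P.prob_space by simp
      qed
    qed (rule int)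
    also have "(LINT x|P. (\<Sum>k. ?g k x)) = char (distr P borel (ratio_map t)) s"
      using exp by (simp add: char_def integral_distr sums_iff)
    finally show ?thesis by (simp only: integral_mult_right_zero integral_complex_of_real)
  qed
  have "char (distr M borel (ratio_map t)) = char (distr N borel (ratio_map t))"
  proof
    fix s
    show "char (distr M borel (ratio_map t)) s = char (distr N borel (ratio_map t)) s"
      using char[OF assms(1), of s, folded mM_def] char[OF assms(2), of s, folded mN_def]
      unfolding mom by (rule sums_unique2)
  qed
  then have distr: "distr M borel (ratio_map t) = distr N borel (ratio_map t)"
    by (intro Levy_uniqueness M.real_distribution_distr N.real_distribution_distr) auto
  \<comment> \<open>The map \<open>y / (t (1 - y))\<close> inverts \<open>ratio_map t\<close> on the
    half-line. Its default value at \<open>y = 1\<close> does no harm, because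
    \<open>ratio_map t x < 1\<close>.\<close>
  have recover: "P = distr (distr P borel (ratio_map t)) borel (\<lambda>y. y / (t * (1 - y)))"
    if "nonneg_distribution P" for P
  proof -
    interpret P: nonneg_distribution P by fact
    have "AE x in P. x = ratio_map t x / (t * (1 - ratio_map t x))"
      using P.nonneg
    proof eventually_elim
      case (elim x)
      have "0 \<le> t * x" using t elim by simp
      then show ?case
        using t by (simp add: one_minus_ratio_map[OF t elim]) (simp add: ratio_map_def)
    qed
    then have "distr P borel (\<lambda>x. x) = distr P borel (\<lambda>x. ratio_map t x / (t * (1 - ratio_map t x)))"
      by (intro distr_cong_AE) auto
    then show ?thesis
      by (simp add: distr_distr comp_def distr_id2)
  qed
  show ?thesis
    using recover[OF assms(1)] recover[OF assms(2)] distr by simp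
qed

section \<open>Injectivity of \<open>Psi\<close> on the left half-plane\<close>

lemma Re_csqrt_pos: "Re a > 0 \<Longrightarrow> 0 < Re (csqrt a) \<and> \<bar>Im (csqrt a)\<bar> < Re (csqrt a)"
proof -
  assume a: "Re a > 0"
  have "Re ((csqrt a)\<^sup>2) > 0" using a by simp
  then have "(Im (csqrt a))\<^sup>2 < (Re (csqrt a))\<^sup>2"
    by (simp add: power2_eq_square del: power2_csqrt)
  moreover have "0 \<le> Re (csqrt a)" using csqrt_principal[of a] by auto
  ultimately show ?thesis
    by (metis abs_le_square_iff abs_of_nonneg linorder_not_le power2_less_0 not_less_iff_gr_or_eq order_le_less power_zero_numeral)
qed

text \<open>Two arguments below \<open>pi / 4\<close> in absolute value add up to one below
  \<open>pi / 2\<close>. Principal roots of numbers in the right half-plane satisfy this, since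
  squaring doubles the argument.\<close>

lemma Re_mult_pos_of_quarter_plane:
  assumes "0 < Re p" "\<bar>Im p\<bar> < Re p" "0 < Re q" "\<bar>Im q\<bar> < Re q"
  shows "0 < Re (p * q)"
proof -
  have "\<bar>Im p * Im q\<bar> < Re p * Re q"
    unfolding abs_mult using assms by (intro mult_strict_mono) auto
  then show ?thesis by (simp add: abs_less_iff)
qed

lemma quarter_plane_inverse:
  assumes "0 < Re p" "\<bar>Im p\<bar> < Re p"
  shows "0 < Re (1 / p)" "\<bar>Im (1 / p)\<bar> < Re (1 / p)"
proof -
  have "0 < (Re p)\<^sup>2 + (Im p)\<^sup>2" using assms by (intro add_pos_nonneg) auto
  then show "0 < Re (1 / p)" "\<bar>Im (1 / p)\<bar> < Re (1 / p)"
    using assms by (auto simp: Re_divide Im_divide intro: divide_strict_right_mono)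
qed

lemma Re_inverse_pos: "0 < Re z \<Longrightarrow> 0 < Re (1 / z)"
  by (simp add: Re_divide power2_eq_square sum_power2_gt_zero_iff add_pos_nonneg)

(* With a = p^2 and b = q^2, the number (1 + a x) (1 + b x) / (p q) equals
   1 / (p q) + (p / q + q / p) x + p q x^2. *)
lemma Re_divided_difference_pos:
  assumes "Re a > 0" "Re b > 0" "0 < x"
  shows "0 < Re (csqrt a * csqrt b * (of_real x / ((1 + a * of_real x) * (1 + b * of_real x))))"
proof -
  define p q X where "p = csqrt a" and "q = csqrt b" and "X = complex_of_real x"
  have p: "0 < Re p" "\<bar>Im p\<bar> < Re p" and q: "0 < Re q" "\<bar>Im q\<bar> < Re q"
    using Re_csqrt_pos assms by (auto simp: p_def q_def)
  have ip: "0 < Re (1 / p)" "\<bar>Im (1 / p)\<bar> < Re (1 / p)" and iq: "0 < Re (1 / q)" "\<bar>Im (1 / q)\<bar> < Re (1 / q)"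
    using quarter_plane_inverse p q by auto
  have nz: "p \<noteq> 0" "q \<noteq> 0" using p q by auto
  have "0 < Re (1 / p * (1 / q) + of_real x * (p * (1 / q) + q * (1 / p)) + of_real (x\<^sup>2) * (p * q))"
    using Re_mult_pos_of_quarter_plane[OF ip iq] Re_mult_pos_of_quarter_plane[OF p iq]
      Re_mult_pos_of_quarter_plane[OF q ip] Re_mult_pos_of_quarter_plane[OF p q] \<open>0 < x\<close>
    unfolding plus_complex.simps times_complex.simps(1)[of "of_real _"] Re_complex_of_real Im_complex_of_real
    by (intro add_pos_pos) simp_all
  also have "1 / p * (1 / q) + of_real x * (p * (1 / q) + q * (1 / p)) + of_real (x\<^sup>2) * (p * q)
      = (1 + p\<^sup>2 * X) * (1 + q\<^sup>2 * X) / (p * q)"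
    using nz by (simp add: X_def field_simps power2_eq_square)
  finally have pos: "0 < Re ((1 + p\<^sup>2 * X) * (1 + q\<^sup>2 * X) / (p * q))" .
  have "0 < x * Re (1 / ((1 + p\<^sup>2 * X) * (1 + q\<^sup>2 * X) / (p * q)))"
    using Re_inverse_pos[OF pos] \<open>0 < x\<close> by (rule mult_pos_pos[rotated])
  also have "\<dots> = Re (X * (1 / ((1 + p\<^sup>2 * X) * (1 + q\<^sup>2 * X) / (p * q))))"
    unfolding X_def times_complex.simps by (simp only: Re_complex_of_real Im_complex_of_real)
  also have "X * (1 / ((1 + p\<^sup>2 * X) * (1 + q\<^sup>2 * X) / (p * q)))
      = p * q * (X / ((1 + p\<^sup>2 * X) * (1 + q\<^sup>2 * X)))"
    by simp
  finally show ?thesis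
    by (simp only: X_def p_def q_def power2_csqrt)
qed

context nonneg_distribution
begin

lemma AE_eq_0_imp_delta0:
  assumes "AE x in M. x = 0"
  shows "M = delta0"
proof -
  have "M = distr M borel (\<lambda>x. x)" by (simp add: distr_id2)
  also have "\<dots> = distr M borel (\<lambda>x. 0)"
    using assms by (intro distr_cong_AE) auto
  also have "\<dots> = delta0" by (rule distr_const) simp
  finally show ?thesis .
qed

text \<open>One resolvent absorbs the factor \<open>x\<close>, through
  \<open>x (- Re z) <= |1 - z x|\<close>; the other is bounded by 1.\<close>

lemma integrable_divided_difference:
  assumes z: "Re z < 0" and w: "Re w < 0"
  shows "integrable M (\<lambda>x. complex_of_real x / ((1 - z * of_real x) * (1 - w * of_real x)))"
proof (rule integrable_const_bound)
  show "AE x in M. norm (complex_of_real x / ((1 - z * of_real x) * (1 - w * of_real x))) \<le> 1 / (- Re z)"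
    using nonneg
  proof eventually_elim
    case (elim x)
    have "x * (- Re z) \<le> Re (1 - z * of_real x)" by simp
    also have "\<dots> \<le> norm (1 - z * of_real x)" by (rule complex_Re_le_cmod)
    finally have "x * (- Re z) \<le> norm (1 - z * of_real x)" .
    then have "x / norm (1 - z * of_real x) \<le> 1 / (- Re z)"
      using one_minus_mult_nonzero[of z x] z elim by (simp add: divide_simps split: if_splits)
    moreover have "norm (1 / (1 - w * complex_of_real x)) \<le> 1"
      using w elim by (intro norm_inverse_one_minus_mult_le_1) auto
    ultimately have "x / norm (1 - z * of_real x) * norm (1 / (1 - w * complex_of_real x)) \<le> 1 / (- Re z) * 1"
      using z elim by (intro mult_mono) (auto simp: divide_simps)
    then show ?case using elim by (simp add: norm_mult norm_divide)
  qed
qed measurable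

text \<open>The difference \<open>Psi z - Psi w\<close> is \<open>z - w\<close> times the integral
  of a divided difference. One rotation, the same for all \<open>x\<close>, moves the values of this
  integrand at \<open>x > 0\<close> into the right half-plane, so a vanishing integral leaves mass
  only at 0.\<close>

lemma Psi_inj_on:
  assumes "M \<noteq> delta0"
  shows "inj_on (Psi M) left_half_plane"
proof (rule inj_onI, rule ccontr)
  fix z w assume "z \<in> left_half_plane" "w \<in> left_half_plane" and eq: "Psi M z = Psi M w" and ne: "z \<noteq> w"
  then have z: "Re z < 0" and w: "Re w < 0" by (auto simp: left_half_plane_def)
  let ?k = "\<lambda>x. complex_of_real x / ((1 - z * of_real x) * (1 - w * of_real x))"
  have int: "integrable M ?k" by (rule integrable_divided_difference[OF z w])
  have "Psi M z - Psi M w = (LINT x|M. 1 / (1 - z * complex_of_real x) - 1 / (1 - w * complex_of_real x))"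
    using z w by (simp add: Psi_eq integrable_Psi_kernel)
  also have "\<dots> = (LINT x|M. (z - w) * ?k x)"
  proof (rule integral_cong_AE)
    show "AE x in M. 1 / (1 - z * complex_of_real x) - 1 / (1 - w * complex_of_real x) = (z - w) * ?k x"
      using nonneg
    proof eventually_elim
      case (elim x)
      then show ?case
        using one_minus_mult_nonzero[of z x] one_minus_mult_nonzero[of w x] z w
        by (simp add: divide_simps) (simp add: algebra_simps)
    qed
  qed measurable
  also have "\<dots> = (z - w) * (LINT x|M. ?k x)"
    by (rule integral_mult_right_zero)
  finally have zero: "(LINT x|M. ?k x) = 0" using eq ne by simp
  define u where "u = csqrt (- z) * csqrt (- w)"
  have "(LINT x|M. Re (u * ?k x)) = Re (LINT x|M. u * ?k x)"
    by (rule integral_Re[OF integrable_mult_right[OF int]])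
  also have "\<dots> = Re (u * (LINT x|M. ?k x))"
    by (simp only: integral_mult_right_zero)
  finally have "(LINT x|M. Re (u * ?k x)) = Re (u * (LINT x|M. ?k x))" .
  then have "(LINT x|M. Re (u * ?k x)) = 0" using zero by simp
  moreover have nn: "0 < Re (u * ?k x)" if "0 < x" for x
    using Re_divided_difference_pos[of "- z" "- w" x] z w that by (simp add: u_def)
  moreover have "AE x in M. 0 \<le> Re (u * ?k x)"
    using nonneg
  proof eventually_elim
    case (elim x)
    show ?case using nn[of x] elim by (cases "x = 0") auto
  qed
  moreover have "integrable M (\<lambda>x. Re (u * ?k x))"
    using int by (intro integrable_Re integrable_mult_right)
  ultimately have "AE x in M. Re (u * ?k x) = 0"
    using integral_nonneg_eq_0_iff_AE by blast
  with nonneg have "AE x in M. x = 0"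
  proof eventually_elim
    case (elim x)
    then show ?case using nn[of x] by (metis less_eq_real_def less_irrefl)
  qed
  then show False using AE_eq_0_imp_delta0 assms by simp
qed

end

section \<open>The transform of the free Poisson distribution\<close>

text \<open>A primitive of \<open>sqrt (r^2 - x^2) / (x + A)\<close>. It results from
  \<open>r^2 - x^2 = (A - x) (A + x) - (A^2 - r^2)\<close>: after division by
  \<open>(x + A) sqrt (r^2 - x^2)\<close> there remain three elementary integrands, one for each
  summand.\<close>

definition semicircle_primitive :: "real \<Rightarrow> real \<Rightarrow> real \<Rightarrow> real" where
  "semicircle_primitive r A x =
     sqrt (r\<^sup>2 - x\<^sup>2) + A * arcsin (x / r)
       - sqrt (A\<^sup>2 - r\<^sup>2) * arcsin ((r\<^sup>2 + A * x) / (r * (A + x)))"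

text \<open>The argument of the second \<open>arcsin\<close> is the Moebius map sending
  \<open>r\<close> to \<open>1\<close> and \<open>- r\<close> to \<open>- 1\<close>. The
  factorisations show that it stays in \<open>[-1, 1]\<close> and evaluate the root in the
  derivative of \<open>arcsin\<close>.\<close>

lemma semicircle_primitive_arg:
  fixes r A x :: real
  assumes "0 < r" "r < A" "- r \<le> x"
  defines "g \<equiv> (r\<^sup>2 + A * x) / (r * (A + x))"
  shows "1 - g = (A - r) * (r - x) / (r * (A + x))" "1 + g = (A + r) * (r + x) / (r * (A + x))"
    "1 - g\<^sup>2 = (A\<^sup>2 - r\<^sup>2) * (r\<^sup>2 - x\<^sup>2) / (r * (A + x))\<^sup>2"
proof -
  have nz: "r * (A + x) \<noteq> 0" using assms by auto
  have g: "g * (r * (A + x)) = r\<^sup>2 + A * x" using nz by (simp add: g_def)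
  show 1: "1 - g = (A - r) * (r - x) / (r * (A + x))"
    using nz g by (simp add: eq_divide_eq) (simp add: algebra_simps power2_eq_square)
  show 2: "1 + g = (A + r) * (r + x) / (r * (A + x))"
    using nz g by (simp add: eq_divide_eq) (simp add: algebra_simps power2_eq_square)
  have "1 - g\<^sup>2 = (1 - g) * (1 + g)" by (simp add: power2_eq_square algebra_simps)
  also have "\<dots> = (A - r) * (r - x) * ((A + r) * (r + x)) / (r * (A + x))\<^sup>2"
    by (simp add: 1 2 power2_eq_square)
  also have "(A - r) * (r - x) * ((A + r) * (r + x)) = (A\<^sup>2 - r\<^sup>2) * (r\<^sup>2 - x\<^sup>2)"
    by (simp add: power2_eq_square algebra_simps)
  finally show "1 - g\<^sup>2 = (A\<^sup>2 - r\<^sup>2) * (r\<^sup>2 - x\<^sup>2) / (r * (A + x))\<^sup>2" .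
qed

lemma DERIV_semicircle_primitive:
  assumes r: "0 < r" "r \<le> A" and x: "- r < x" "x < r"
  shows "(semicircle_primitive r A has_real_derivative sqrt (r\<^sup>2 - x\<^sup>2) / (x + A)) (at x)"
proof -
  define R where "R = sqrt (r\<^sup>2 - x\<^sup>2)"
  define B where "B = sqrt (A\<^sup>2 - r\<^sup>2)"
  have x2: "x\<^sup>2 < r\<^sup>2" using x r by (metis abs_less_iff abs_of_pos minus_less_iff power2_abs power_strict_mono abs_ge_zero pos2)
  have R: "0 < R" "R\<^sup>2 = r\<^sup>2 - x\<^sup>2" using x2 by (auto simp: R_def)
  have B: "0 \<le> B" "B\<^sup>2 = A\<^sup>2 - r\<^sup>2" using r by (auto simp: B_def power_mono)
  have Ax: "0 < A + x" using x r by simp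
  have d1: "((\<lambda>x. sqrt (r\<^sup>2 - x\<^sup>2)) has_real_derivative - x / R) (at x)"
    using x2 unfolding R_def by (auto intro!: derivative_eq_intros simp: field_simps)
  have d2: "((\<lambda>x. A * arcsin (x / r)) has_real_derivative A / R) (at x)"
  proof -
    have "-1 < x / r" "x / r < 1" using r x by (auto simp: field_simps)
    then have "((\<lambda>x. A * arcsin (x / r)) has_real_derivative A * (inverse (sqrt (1 - (x / r)\<^sup>2)) * (1 / r))) (at x)"
      using r(1) by (auto intro!: derivative_eq_intros)
    moreover have "1 - (x / r)\<^sup>2 = (R / r)\<^sup>2"
      using r(1) by (simp add: power_divide R(2) diff_divide_distrib)
    then have "sqrt (1 - (x / r)\<^sup>2) = R / r" using R r by (simp add: real_sqrt_unique)
    ultimately show ?thesis using r by simp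
  qed
  have d3: "((\<lambda>x. B * arcsin ((r\<^sup>2 + A * x) / (r * (A + x)))) has_real_derivative B\<^sup>2 / ((A + x) * R)) (at x)"
  \<comment> \<open>For \<open>B = 0\<close>, that is \<open>A = r\<close>, the inner argument is
    constantly 1, where \<open>arcsin\<close> is not differentiable; the factor \<open>B\<close>
    removes the term. This case occurs for the total mass when \<open>c = 1\<close>.\<close>
  proof (cases "B = 0")
    case False
    then have "A \<noteq> r" by (auto simp: B_def)
    then have rA: "r < A" using r by simp
    define g where "g = (r\<^sup>2 + A * x) / (r * (A + x))"
    have "0 < 1 - g" "0 < 1 + g"
      unfolding g_def semicircle_primitive_arg(1,2)[OF r(1) rA less_imp_le[OF x(1)]]
      using r(1) rA x Ax by (auto intro!: divide_pos_pos mult_pos_pos)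
    then have g: "-1 < g" "g < 1" by auto
    have "1 - g\<^sup>2 = (B * R / (r * (A + x)))\<^sup>2"
      unfolding g_def semicircle_primitive_arg(3)[OF r(1) rA less_imp_le[OF x(1)]]
      using R B by (simp add: power_divide power_mult_distrib)
    moreover have "0 \<le> B * R / (r * (A + x))" using B R r Ax by simp
    ultimately have s: "sqrt (1 - g\<^sup>2) = B * R / (r * (A + x))" by (metis real_sqrt_unique)
    have dg: "((\<lambda>x. (r\<^sup>2 + A * x) / (r * (A + x))) has_real_derivative
        (A * (r * (A + x)) - (r\<^sup>2 + A * x) * r) / (r * (A + x))\<^sup>2) (at x)"
      using r Ax by (auto intro!: derivative_eq_intros simp: power2_eq_square)
    have "A * (r * (A + x)) - (r\<^sup>2 + A * x) * r = r * B\<^sup>2"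
      unfolding B(2) by (simp add: power2_eq_square algebra_simps)
    with dg have dg: "((\<lambda>x. (r\<^sup>2 + A * x) / (r * (A + x))) has_real_derivative r * B\<^sup>2 / (r * (A + x))\<^sup>2) (at x)"
      by simp
    have "((\<lambda>x. arcsin ((r\<^sup>2 + A * x) / (r * (A + x)))) has_real_derivative
        inverse (sqrt (1 - g\<^sup>2)) * (r * B\<^sup>2 / (r * (A + x))\<^sup>2)) (at x)"
      using DERIV_chain2[OF DERIV_arcsin dg] g unfolding g_def by blast
    from DERIV_cmult[OF this, of B]
    have "((\<lambda>x. B * arcsin ((r\<^sup>2 + A * x) / (r * (A + x)))) has_real_derivative
        B * (inverse (sqrt (1 - g\<^sup>2)) * (r * B\<^sup>2 / (r * (A + x))\<^sup>2))) (at x)" .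
    moreover have "B * (inverse (sqrt (1 - g\<^sup>2)) * (r * B\<^sup>2 / (r * (A + x))\<^sup>2)) = B\<^sup>2 / ((A + x) * R)"
      using False r R(1) Ax unfolding s by (simp add: power2_eq_square)
    ultimately show ?thesis by simp
  qed simp
  have "(semicircle_primitive r A has_real_derivative - x / R + A / R - B\<^sup>2 / ((A + x) * R)) (at x)"
    unfolding semicircle_primitive_def[abs_def] B_def[symmetric]
    by (intro DERIV_add DERIV_diff d1 d2 d3)
  moreover have "- x / R + A / R - B\<^sup>2 / ((A + x) * R) = R / (x + A)"
  proof -
    have "- x / R + A / R = (A - x) / R" by (simp add: diff_divide_distrib)
    also have "\<dots> = (A - x) * (A + x) / ((A + x) * R)" using Ax by simp
    finally have "- x / R + A / R - B\<^sup>2 / ((A + x) * R) = ((A - x) * (A + x) - B\<^sup>2) / ((A + x) * R)"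
      by (simp only: diff_divide_distrib)
    also have "(A - x) * (A + x) - B\<^sup>2 = R * R"
      using R(2) B(2) by (simp add: power2_eq_square algebra_simps)
    finally show ?thesis using R(1) by (simp add: add.commute)
  qed
  ultimately show ?thesis by (simp add: R_def)
qed

lemma continuous_on_semicircle_primitive:
  assumes r: "0 < r" "r \<le> A"
  shows "continuous_on {- r..r} (semicircle_primitive r A)"
proof -
  have 1: "continuous_on {- r..r} (\<lambda>x. arcsin (x / r))"
    using r by (intro continuous_on_arcsin continuous_intros) (auto simp: field_simps)
  have 2: "continuous_on {- r..r} (\<lambda>x. sqrt (A\<^sup>2 - r\<^sup>2) * arcsin ((r\<^sup>2 + A * x) / (r * (A + x))))"
  proof (cases "A = r")
    case False
    then have rA: "r < A" using r by simp
    have "continuous_on {- r..r} (\<lambda>x. (r\<^sup>2 + A * x) / (r * (A + x)))"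
      using r rA by (intro continuous_intros) auto
    moreover have "- 1 \<le> (r\<^sup>2 + A * x) / (r * (A + x)) \<and> (r\<^sup>2 + A * x) / (r * (A + x)) \<le> 1"
      if x: "x \<in> {- r..r}" for x
    proof -
      define g where "g = (r\<^sup>2 + A * x) / (r * (A + x))"
      have mr: "- r \<le> x" using x by simp
      have "0 \<le> 1 - g" "0 \<le> 1 + g"
        unfolding g_def semicircle_primitive_arg(1,2)[OF r(1) rA mr]
        using r(1) rA x by (auto intro!: divide_nonneg_nonneg mult_nonneg_nonneg)
      then show ?thesis by (simp add: g_def)
    qed
    ultimately show ?thesis
      by (intro continuous_on_mult continuous_on_const continuous_on_arcsin) auto
  qed simp
  show ?thesis
    unfolding semicircle_primitive_def[abs_def]
    by (intro continuous_on_add continuous_on_diff continuous_on_mult continuous_on_const 1 2)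
      (intro continuous_intros)
qed

lemma semicircle_primitive_ends:
  assumes r: "0 < r" "r \<le> A"
  shows "semicircle_primitive r A r - semicircle_primitive r A (- r) = pi * (A - sqrt (A\<^sup>2 - r\<^sup>2))"
proof (cases "A = r")
  case True
  then show ?thesis using r by (simp add: semicircle_primitive_def)
next
  case False
  then have rA: "r < A" using r by simp
  have "(r\<^sup>2 + A * r) / (r * (A + r)) = 1" "(r\<^sup>2 + A * (- r)) / (r * (A + (- r))) = - 1"
  proof -
    have "r\<^sup>2 + A * r = r * (A + r)" "r\<^sup>2 + A * (- r) = - (r * (A + (- r)))"
      by (simp_all add: power2_eq_square algebra_simps)
    moreover have nz: "r * (A + r) \<noteq> 0" "r * (A + (- r)) \<noteq> 0" using r rA by auto
    ultimately show "(r\<^sup>2 + A * r) / (r * (A + r)) = 1" "(r\<^sup>2 + A * (- r)) / (r * (A + (- r))) = - 1"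
      by (simp_all only: divide_self[OF nz(1)] divide_self[OF nz(2)] minus_divide_left[symmetric])
  qed
  then show ?thesis using r by (simp add: semicircle_primitive_def algebra_simps)
qed

lemma has_integral_semicircle_over_shift:
  assumes r: "0 < r" "r \<le> a + m"
  shows "((\<lambda>x. sqrt (r\<^sup>2 - (x - m)\<^sup>2) / (x + a)) has_integral
    pi * (a + m - sqrt ((a + m)\<^sup>2 - r\<^sup>2))) {m - r..m + r}"
proof -
  let ?F = "\<lambda>x. semicircle_primitive r (a + m) (x - m)"
  have "((\<lambda>x. sqrt (r\<^sup>2 - (x - m)\<^sup>2) / (x + a)) has_integral ?F (m + r) - ?F (m - r)) {m - r..m + r}"
  \<comment> \<open>The summands of the primitive are continuous but not differentiable at the ends
    of the interval.\<close>
  proof (rule fundamental_theorem_of_calculus_interior)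
    show "continuous_on {m - r..m + r} ?F"
      by (rule continuous_on_compose2[OF continuous_on_semicircle_primitive[OF r]])
        (auto intro!: continuous_intros)
    fix x assume x: "x \<in> {m - r<..<m + r}"
    have "(?F has_real_derivative sqrt (r\<^sup>2 - (x - m)\<^sup>2) / (x - m + (a + m)) * 1) (at x)"
      by (rule DERIV_chain2[OF DERIV_semicircle_primitive]) (use r x in \<open>auto intro!: derivative_eq_intros\<close>)
    then show "(?F has_vector_derivative sqrt (r\<^sup>2 - (x - m)\<^sup>2) / (x + a)) (at x)"
      by (simp add: has_real_derivative_iff_has_vector_derivative[symmetric] algebra_simps)
  qed (use r in auto)
  then show ?thesis using semicircle_primitive_ends[OF r] by simp
qed

section \<open>Integrals against the Marchenko-Pastur density\<close>

lemma mp_density_nonneg: "0 < c \<Longrightarrow> 0 \<le> mp_density c x"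
proof (cases "x \<in> {(1 - sqrt c)\<^sup>2..(1 + sqrt c)\<^sup>2}")
  assume c: "0 < c"
  case True
  then have "(1 - sqrt c)\<^sup>2 \<le> x" by simp
  then have x: "0 \<le> x" by (rule order_trans[OF zero_le_power2])
  have "(1 - sqrt c)\<^sup>2 = 1 + c - 2 * sqrt c" "(1 + sqrt c)\<^sup>2 = 1 + c + 2 * sqrt c"
    using c by (auto simp: power2_eq_square algebra_simps)
  with True have "\<bar>x - 1 - c\<bar> \<le> 2 * sqrt c" by auto
  then have "\<bar>x - 1 - c\<bar>\<^sup>2 \<le> (2 * sqrt c)\<^sup>2" by (intro power_mono) auto
  also have "(2 * sqrt c)\<^sup>2 = 4 * c" using c by simp
  finally have "0 \<le> 4 * c - (x - 1 - c)\<^sup>2" by simp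
  then show ?thesis using x by (simp add: mp_density_def)
qed (simp add: mp_density_def)

lemma mp_density_measurable [measurable]: "mp_density c \<in> borel_measurable borel"
  unfolding mp_density_def[abs_def] by measurable

lemma mp_density_supp: "mp_density c x \<noteq> 0 \<Longrightarrow> 0 < x"
proof -
  assume "mp_density c x \<noteq> 0"
  then have "x \<noteq> 0" "(1 - sqrt c)\<^sup>2 \<le> x"
    by (auto simp: mp_density_def indicator_def split: if_splits)
  then show ?thesis using zero_le_power2[of "1 - sqrt c"] by linarith
qed

text \<open>The factor \<open>x\<close> cancels the \<open>1 / x\<close> of the density and leaves a
  semicircle over a shifted variable. The value \<open>a = 0\<close> gives the total mass, and
  \<open>a = 1 / t\<close> gives \<open>Psi\<close> at \<open>- t\<close>.\<close>

lemma has_bochner_integral_mp_density: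
  assumes c: "0 < c" and a: "0 \<le> a"
  shows "has_bochner_integral lborel (\<lambda>x. mp_density c x * (x / (x + a)))
           ((a + 1 + c - sqrt ((a + 1 + c)\<^sup>2 - 4 * c)) / 2)"
proof -
  let ?r = "2 * sqrt c" and ?m = "1 + c"
  let ?I = "(a + 1 + c - sqrt ((a + 1 + c)\<^sup>2 - 4 * c)) / 2"
  have iv: "(1 - sqrt c)\<^sup>2 = ?m - ?r" "(1 + sqrt c)\<^sup>2 = ?m + ?r"
    using c by (auto simp: power2_eq_square algebra_simps)
  have r: "0 < ?r" "?r \<le> a + ?m"
    using c a zero_le_power2[of "1 - sqrt c"] unfolding iv by auto
  have "((\<lambda>x. 1 / (2 * pi) * (sqrt (?r\<^sup>2 - (x - ?m)\<^sup>2) / (x + a))) has_integral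
      1 / (2 * pi) * (pi * (a + ?m - sqrt ((a + ?m)\<^sup>2 - ?r\<^sup>2)))) {?m - ?r..?m + ?r}"
    by (intro has_integral_mult_right has_integral_semicircle_over_shift r)
  moreover have "1 / (2 * pi) * (pi * (a + ?m - sqrt ((a + ?m)\<^sup>2 - ?r\<^sup>2))) = ?I"
    using c by (simp add: add.assoc)
  ultimately have int: "((\<lambda>x. 1 / (2 * pi) * (sqrt (?r\<^sup>2 - (x - ?m)\<^sup>2) / (x + a))) has_integral ?I) {?m - ?r..?m + ?r}"
    by (simp only:)
  have eq: "mp_density c x * (x / (x + a)) = 1 / (2 * pi) * (sqrt (?r\<^sup>2 - (x - ?m)\<^sup>2) / (x + a))"
    if "x \<in> {?m - ?r..?m + ?r}" for x
  \<comment> \<open>The point 0 lies in the support interval only for \<open>c = 1\<close>, and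
    there both sides vanish.\<close>
  proof (cases "x = 0")
    case True
    then have "?m - ?r \<le> 0" using that by simp
    then have "(1 - sqrt c)\<^sup>2 \<le> 0" by (simp only: iv)
    then have "c = 1" using c by simp
    then show ?thesis using True by (simp add: mp_density_def)
  next
    case False
    have "4 * c - (x - 1 - c)\<^sup>2 = ?r\<^sup>2 - (x - ?m)\<^sup>2" using c by (simp add: diff_diff_eq)
    then have "mp_density c x = 1 / (2 * pi * x) * sqrt (?r\<^sup>2 - (x - ?m)\<^sup>2)"
      using that by (simp add: mp_density_def iv)
    then show ?thesis using False by (simp only: times_divide_times_eq mult_1) simp
  qed
  have "((\<lambda>x. mp_density c x * (x / (x + a))) has_integral ?I) {?m - ?r..?m + ?r}"
    by (rule has_integral_eq[OF _ int]) (use eq in simp)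
  then have "(\<integral>\<^sup>+x. ennreal (mp_density c x * (x / (x + a))) * indicator {?m - ?r..?m + ?r} x \<partial>lborel) = ennreal ?I"
    by (rule nn_integral_has_integral_lebesgue'[rotated])
      (use mp_density_nonneg[OF c] a r zero_le_power2[of "1 - sqrt c"] in \<open>auto simp: iv\<close>)
  moreover have "ennreal (mp_density c x * (x / (x + a))) * indicator {?m - ?r..?m + ?r} x
      = ennreal (mp_density c x * (x / (x + a)))" for x
    by (simp add: mp_density_def iv split: split_indicator)
  ultimately have nn: "(\<integral>\<^sup>+x. ennreal (mp_density c x * (x / (x + a))) \<partial>lborel) = ennreal ?I"
    by simp
  show ?thesis
  proof (rule has_bochner_integral_nn_integral[OF _ _ _ nn])
    show "AE x in lborel. 0 \<le> mp_density c x * (x / (x + a))"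
    proof (rule AE_I2)
      fix x
      show "0 \<le> mp_density c x * (x / (x + a))"
        using mp_density_supp[of c x] mp_density_nonneg[OF c, of x] a
        by (cases "mp_density c x = 0") auto
    qed
    have "sqrt ((a + 1 + c)\<^sup>2 - 4 * c) \<le> sqrt ((a + 1 + c)\<^sup>2)"
      using c by (intro real_sqrt_le_mono) simp
    then show "0 \<le> ?I" using a c by simp
  qed measurable
qed

lemma free_poisson_eq_density:
  assumes "1 \<le> c"
  shows "free_poisson c = density lborel (\<lambda>x. ennreal (mp_density c x))"
  by (rule measure_eqI) (use assms in \<open>auto simp: emeasure_free_poisson emeasure_density\<close>)

text \<open>For \<open>a = 0\<close> the radicand is \<open>(c - 1)^2\<close>, and
  \<open>c >= 1\<close> selects the root \<open>c - 1\<close>. For \<open>0 < c < 1\<close> the same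
  formula would give the mass \<open>c\<close>, the rest being the atom at 0.\<close>

lemma mp_density_total:
  assumes "1 \<le> c"
  shows "has_bochner_integral lborel (mp_density c) 1"
proof -
  have "(1 + c)\<^sup>2 - 4 * c = (c - 1)\<^sup>2" by (simp add: power2_eq_square algebra_simps)
  then have "(0 + 1 + c - sqrt ((0 + 1 + c)\<^sup>2 - 4 * c)) / 2 = 1"
    using assms by simp
  moreover have "mp_density c x * (x / (x + 0)) = mp_density c x" for x
    by (simp add: mp_density_def)
  moreover have "0 < c" using assms by simp
  ultimately show ?thesis
    using has_bochner_integral_mp_density[of c 0] by (simp only: order_refl)
qed

lemma nonneg_distribution_free_poisson:
  assumes c: "1 \<le> c"
  shows "nonneg_distribution (free_poisson c)"
proof -
  have "(\<integral>\<^sup>+x. ennreal (mp_density c x) \<partial>lborel) = 1"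
    using mp_density_total[OF c] c mp_density_nonneg[of c]
    by (subst nn_integral_eq_integral) (auto simp: has_bochner_integral_iff)
  then have "prob_space (free_poisson c)"
    unfolding free_poisson_eq_density[OF c]
    by (intro prob_spaceI) (simp add: emeasure_density)
  then interpret prob_space "free_poisson c" .
  show ?thesis
  proof
    show "AE x in free_poisson c. 0 \<le> x"
      unfolding free_poisson_eq_density[OF c]
    proof (subst AE_density)
      show "AE x in lborel. 0 < ennreal (mp_density c x) \<longrightarrow> 0 \<le> x"
        using mp_density_supp[of c] by (intro AE_I2) (metis ennreal_0 less_irrefl less_imp_le)
    qed measurable
  qed auto
qed

lemma Psi_free_poisson:
  assumes c: "1 \<le> c" and t: "0 < t"
  defines "A \<equiv> 1 / t + 1 + c"
  shows "Psi (free_poisson c) (- complex_of_real t) = of_real (- (A - sqrt (A\<^sup>2 - 4 * c)) / 2)"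
proof -
  interpret nonneg_distribution "free_poisson c"
    by (rule nonneg_distribution_free_poisson[OF c])
  have nn: "0 \<le> mp_density c x" for x using mp_density_nonneg c by simp
  have "(LINT x|free_poisson c. 1 / (1 - - complex_of_real t * complex_of_real x))
      = (LINT x|free_poisson c. complex_of_real (1 / (1 + t * x)))"
    by simp
  also have "\<dots> = of_real (LINT x|free_poisson c. 1 / (1 + t * x))"
    by (rule integral_complex_of_real)
  also have "(LINT x|free_poisson c. 1 / (1 + t * x)) = (LINT x|lborel. mp_density c x * (1 / (1 + t * x)))"
    unfolding free_poisson_eq_density[OF c] using nn
    by (subst integral_density) auto
  also have "\<dots> = (LINT x|lborel. mp_density c x - mp_density c x * (x / (x + 1 / t)))"
  proof (rule Bochner_Integration.integral_cong)
    fix x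
    show "mp_density c x * (1 / (1 + t * x)) = mp_density c x - mp_density c x * (x / (x + 1 / t))"
    proof (cases "mp_density c x = 0")
      case False
      then have x: "0 < x" by (rule mp_density_supp)
      have "x + 1 / t = (1 + t * x) / t" using t by (simp add: field_simps)
      then have "x / (x + 1 / t) = t * x / (1 + t * x)" by (simp add: mult.commute)
      moreover have "1 + t * x \<noteq> 0" using t x add_pos_pos[of 1 "t * x"] by simp
      moreover have "1 / (1 + t * x) = (1 + t * x) / (1 + t * x) - t * x / (1 + t * x)"
        unfolding diff_divide_distrib[symmetric] by simp
      ultimately have "1 / (1 + t * x) = 1 - x / (x + 1 / t)" by (metis divide_self)
      then show ?thesis by (simp only: right_diff_distrib mult_1_right)
    qed simp
  qed simp
  also have "\<dots> = 1 - (A - sqrt (A\<^sup>2 - 4 * c)) / 2"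
    using has_bochner_integral_diff[OF mp_density_total[OF c] has_bochner_integral_mp_density[of c "1 / t"]] c t
    by (simp add: has_bochner_integral_iff A_def)
  finally have "Psi (free_poisson c) (- complex_of_real t) = of_real (1 - (A - sqrt (A\<^sup>2 - 4 * c)) / 2) - 1"
    using Psi_eq[of "- complex_of_real t"] t by simp
  also have "\<dots> = of_real (1 - (A - sqrt (A\<^sup>2 - 4 * c)) / 2 - 1)"
    by (simp only: of_real_diff of_real_1)
  moreover have "1 - X / 2 - 1 = - X / 2" for X :: real by simp
  ultimately show ?thesis by metis
qed

text \<open>For \<open>t = - w / ((1 + w) (c + w))\<close> the quantity \<open>1 / t + 1 + c\<close>
  is \<open>- c / w - w\<close>, which makes the radicand the square of \<open>w - c / w\<close>.
  That number is nonnegative because \<open>w^2 <= 1 <= c\<close> and \<open>w < 0\<close>.\<close>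

lemma Psi_free_poisson_inverse:
  assumes c: "1 \<le> c" and w: "-1 < w" "w < 0"
  shows "Psi (free_poisson c) (of_real (w / ((1 + w) * (c + w)))) = of_real w"
proof -
  define t where "t = - w / ((1 + w) * (c + w))"
  have cw: "0 < 1 + w" "0 < c + w" using c w by auto
  have t: "0 < t" using w cw by (simp add: t_def divide_neg_pos)
  have A: "1 / t + 1 + c = - (c / w) - w"
    using w cw by (simp add: t_def divide_simps) (simp add: algebra_simps)
  have "(- (c / w) - w)\<^sup>2 - 4 * c = (w - c / w)\<^sup>2"
    using w by (simp add: power2_eq_square algebra_simps)
  moreover have "0 \<le> w - c / w"
  proof -
    have "w * w \<le> 1 * 1" using w mult_mono[of "- w" 1 "- w" 1] by simp
    then have "w * w \<le> c" using c by simp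
    then show ?thesis using w by (simp add: divide_simps)
  qed
  ultimately have sqrt: "sqrt ((- (c / w) - w)\<^sup>2 - 4 * c) = w - c / w" by simp
  have "of_real (w / ((1 + w) * (c + w))) = - complex_of_real t" by (simp add: t_def)
  then show ?thesis
    using Psi_free_poisson[OF c t] by (simp only: A sqrt) simp
qed

section \<open>Functions with positive real part\<close>

text \<open>The Poisson kernel of the disc at a real point, carried to the right half-plane. With
  \<open>x = (1 - y) / y\<close> it is \<open>q / (1 + q^2 x)\<close> divided by \<open>y\<close>.
  The variable \<open>y\<close> compactifies the half-line, \<open>y = 0\<close> standing for
  \<open>x\<close> at infinity, and the kernel is 1 at \<open>q = 1\<close>.\<close>

definition half_line_kernel :: "real \<Rightarrow> real \<Rightarrow> real" where
  "half_line_kernel q y = q / (y + q\<^sup>2 * (1 - y))"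

definition unit_interval_distribution :: "real measure \<Rightarrow> bool" where
  "unit_interval_distribution \<kappa> \<longleftrightarrow> real_distribution \<kappa> \<and> (AE y in \<kappa>. 0 \<le> y \<and> y \<le> 1)"

text \<open>Only real \<open>q\<close> occur, so that the property passes to limits that are known
  on the positive axis alone.\<close>

definition kernel_representable :: "(real \<Rightarrow> real) \<Rightarrow> bool" where
  "kernel_representable h \<longleftrightarrow> (\<exists>\<kappa>. unit_interval_distribution \<kappa> \<and>
     (\<forall>q>0. h q = (LINT y|\<kappa>. half_line_kernel q y)))"

lemma half_line_kernel_denominator:
  fixes y q :: real
  assumes "0 \<le> y" "y \<le> 1"
  shows "min 1 (q\<^sup>2) \<le> y + q\<^sup>2 * (1 - y)"
proof -
  have "m = y * m + (1 - y) * m" for m :: real by (simp add: algebra_simps)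
  then have "min 1 (q\<^sup>2) = y * min 1 (q\<^sup>2) + (1 - y) * min 1 (q\<^sup>2)" .
  also have "\<dots> \<le> y * 1 + (1 - y) * q\<^sup>2"
    using assms by (intro add_mono mult_left_mono) auto
  finally show ?thesis by (simp add: mult.commute)
qed

lemma half_line_kernel_bounds:
  assumes "0 \<le> y" "y \<le> 1" "0 < q"
  shows "0 \<le> half_line_kernel q y" "half_line_kernel q y \<le> q / min 1 (q\<^sup>2)"
proof -
  have m: "0 < min 1 (q\<^sup>2)" using assms by simp
  then have pos: "0 < y + q\<^sup>2 * (1 - y)"
    by (rule order_less_le_trans[OF _ half_line_kernel_denominator]) (use assms in auto)
  then show "0 \<le> half_line_kernel q y" using assms by (simp add: half_line_kernel_def)
  show "half_line_kernel q y \<le> q / min 1 (q\<^sup>2)"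
    unfolding half_line_kernel_def
    using half_line_kernel_denominator[of y q] assms m pos by (intro divide_left_mono mult_pos_pos) auto
qed

lemma half_line_kernel_measurable [measurable]: "half_line_kernel q \<in> borel_measurable borel"
  unfolding half_line_kernel_def[abs_def] by measurable

text \<open>All representing measures live on the compact interval \<open>[0, 1]\<close>, where the
  kernel is continuous for fixed \<open>q > 0\<close>; a weakly convergent subsequence then
  represents the limit at every \<open>q\<close> at once.\<close>

lemma kernel_representable_limit:
  assumes rep: "\<And>n. kernel_representable (h n)"
    and lim: "\<And>q. 0 < q \<Longrightarrow> (\<lambda>n. h n q) \<longlonglongrightarrow> g q"
  shows "kernel_representable g"
proof -
  obtain \<kappa> where \<kappa>: "\<And>n. unit_interval_distribution (\<kappa> n)"
    and h: "\<And>n q. 0 < q \<Longrightarrow> h n q = (LINT y|\<kappa> n. half_line_kernel q y)"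
    using rep unfolding kernel_representable_def by metis
  have dist: "real_distribution (\<kappa> n)" for n
    using \<kappa> by (simp add: unit_interval_distribution_def)
  have AE: "AE y in \<kappa> n. 0 \<le> y \<and> y \<le> 1" for n
    using \<kappa> by (simp add: unit_interval_distribution_def)
  have "tight \<kappa>"
    unfolding tight_def
  proof safe
    show "real_distribution (\<kappa> n)" for n by (rule dist)
    fix e :: real assume "0 < e"
    \<comment> \<open>Tightness is phrased with half-open intervals, so the left end must lie below
      0.\<close>
    have "measure (\<kappa> n) {-1<..1} = 1" for n
    proof -
      interpret real_distribution "\<kappa> n" by (rule dist)
      show ?thesis
        using AE[of n] by (subst prob_eq_1) (auto elim!: eventually_mono)
    qed
    with \<open>0 < e\<close> show "\<exists>a b. a < b \<and> (\<forall>n. 1 - e < measure (\<kappa> n) {a<..b})"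
      by (intro exI[of _ "-1"] exI[of _ 1]) simp
  qed
  from tight_imp_convergent_subsubsequence[OF this strict_mono_id]
  obtain s M where s: "strict_mono s" and M: "real_distribution M"
    and weak: "weak_conv_m (\<kappa> \<circ> s) M" by auto
  have conv: "(\<lambda>n. LINT y|\<kappa> (s n). f y) \<longlonglongrightarrow> (LINT y|M. f y)"
    if "\<And>y. isCont f y" "\<And>y. \<bar>f y\<bar> \<le> B" for f :: "real \<Rightarrow> real" and B
    using weak_conv_imp_integral_bdd_continuous_conv[of "\<kappa> \<circ> s" M f B] dist M weak that
    by (simp add: comp_def)
  have AEM: "AE y in M. 0 \<le> y \<and> y \<le> 1"
  proof -
    interpret M: real_distribution M by (rule M)
    \<comment> \<open>The distance to \<open>[0, 1]\<close>, truncated at 1: a bounded continuous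
      test function whose zero set is the interval.\<close>
    define f where "f y = min 1 (max 0 (- y) + max 0 (y - 1))" for y :: real
    have "(\<lambda>n. LINT y|\<kappa> (s n). f y) \<longlonglongrightarrow> (LINT y|M. f y)"
    proof (rule conv[where B = 1])
      show "isCont f y" for y unfolding f_def[abs_def] by (intro continuous_intros)
      show "\<bar>f y\<bar> \<le> 1" for y by (auto simp: f_def)
    qed
    moreover have "(LINT y|\<kappa> (s n). f y) = 0" for n
      by (rule integral_eq_zero_AE) (use AE[of "s n"] in eventually_elim, auto simp: f_def)
    ultimately have "(LINT y|M. f y) = 0"
      by (simp add: LIMSEQ_const_iff)
    moreover have "integrable M f"
      by (rule M.integrable_const_bound[where B = 1]) (auto simp: f_def[abs_def])
    moreover have "AE y in M. 0 \<le> f y" by (simp add: f_def)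
    ultimately have "AE y in M. f y = 0"
      using integral_nonneg_eq_0_iff_AE by blast
    then show ?thesis
    proof eventually_elim
      case (elim y)
      then show ?case unfolding f_def by linarith
    qed
  qed
  \<comment> \<open>Weak convergence needs functions that are bounded and continuous on the whole
    line; clamping extends the kernel beyond \<open>[0, 1]\<close> without changing the
    integrals.\<close>
  define cl where "cl y = max 0 (min 1 y)" for y :: real
  have cl: "0 \<le> cl y" "cl y \<le> 1" for y by (auto simp: cl_def)
  have cl_cong: "(LINT y|N. half_line_kernel q (cl y)) = (LINT y|N. half_line_kernel q y)"
    if "AE y in N. 0 \<le> y \<and> y \<le> 1" "sets N = sets borel" for N q
  proof (rule integral_cong_AE)
    show "AE y in N. half_line_kernel q (cl y) = half_line_kernel q y"
      using that(1) by eventually_elim (simp add: cl_def)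
    have [measurable]: "cl \<in> borel_measurable borel" unfolding cl_def[abs_def] by measurable
    show "(\<lambda>y. half_line_kernel q (cl y)) \<in> borel_measurable N"
      "half_line_kernel q \<in> borel_measurable N"
      unfolding measurable_cong_sets[OF that(2) refl] by measurable
  qed
  have "g q = (LINT y|M. half_line_kernel q y)" if q: "0 < q" for q
  proof (rule LIMSEQ_unique)
    show "(\<lambda>n. h (s n) q) \<longlonglongrightarrow> g q"
      using LIMSEQ_subseq_LIMSEQ[OF lim[OF q] s] by (simp add: comp_def)
    have "(\<lambda>n. LINT y|\<kappa> (s n). half_line_kernel q (cl y)) \<longlonglongrightarrow> (LINT y|M. half_line_kernel q (cl y))"
    proof (rule conv)
      fix y
      show "\<bar>half_line_kernel q (cl y)\<bar> \<le> q / min 1 (q\<^sup>2)"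
        using half_line_kernel_bounds[OF cl q, of y] by simp
      have "isCont cl y" unfolding cl_def[abs_def] by (intro continuous_intros)
      moreover have "cl y + q\<^sup>2 * (1 - cl y) \<noteq> 0"
        using half_line_kernel_denominator[OF cl, of q y] q
        by (smt (verit) zero_less_power)
      ultimately show "isCont (\<lambda>y. half_line_kernel q (cl y)) y"
        unfolding half_line_kernel_def by (intro continuous_intros)
    qed
    then show "(\<lambda>n. h (s n) q) \<longlonglongrightarrow> (LINT y|M. half_line_kernel q y)"
      using dist M AE AEM
      by (simp add: h[OF q] cl_cong real_distribution.events_eq_borel)
  qed
  moreover have "unit_interval_distribution M"
    using M AEM by (simp add: unit_interval_distribution_def)
  ultimately show ?thesis unfolding kernel_representable_def by blast
qed

(* Cauchy's formula for H z (1 - u^2) / (1 - u z) at the real point u: on the unit circle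
   z / ((z - u) (1 - u z)) = 1 / |1 - u z|^2. *)
lemma poisson_formula_real:
  assumes H: "H holomorphic_on cball 0 1" and u: "- 1 < u" "u < 1"
  shows "((\<lambda>t. Re (H (cis (2 * pi * t))) * ((1 - u\<^sup>2) / (1 - 2 * u * cos (2 * pi * t) + u\<^sup>2)))
    has_integral Re (H (of_real u))) {0..1}"
proof -
  define U where "U = complex_of_real u"
  define g where "g z = H z * (1 - U\<^sup>2) / (1 - U * z)" for z
  define K where "K = 2 * complex_of_real pi * \<i>"
  have K: "K \<noteq> 0" by (simp add: K_def)
  have nU: "norm U < 1" using u by (simp add: U_def abs_less_iff)
  have nz: "1 - U * z \<noteq> 0" if "norm z \<le> 1" for z
  proof
    assume "1 - U * z = 0"
    then have "norm (U * z) = 1" by (metis eq_iff_diff_eq_0 norm_one)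
    moreover have "norm (U * z) < 1"
      using that nU by (simp add: norm_mult) (smt (verit) mult_left_le norm_ge_zero)
    ultimately show False by simp
  qed
  have "g holomorphic_on cball 0 1"
    unfolding g_def[abs_def] by (intro holomorphic_intros H) (use nz in auto)
  from Cauchy_integral_circlepath_simple[OF this, of U]
  have "((\<lambda>z. g z / (z - U)) has_contour_integral K * g U) (circlepath 0 1)"
    using nU by (simp add: K_def)
  then have "((\<lambda>t. g (circlepath 0 1 t) / (circlepath 0 1 t - U)
      * vector_derivative (circlepath 0 1) (at t within {0..1})) has_integral K * g U) {0..1}"
    by (simp add: has_contour_integral_def)
  from has_integral_mult_right[OF this, of "1 / K"]
  have int: "((\<lambda>t. 1 / K * (g (circlepath 0 1 t) / (circlepath 0 1 t - U)
      * vector_derivative (circlepath 0 1) (at t within {0..1}))) has_integral g U) {0..1}"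
    using K by simp
  have "1 - U\<^sup>2 \<noteq> 0" using nz[of U] nU by (simp add: power2_eq_square)
  then have gU: "g U = H U" by (simp add: g_def power2_eq_square)
  have "((\<lambda>t. H (cis (2 * pi * t)) * of_real ((1 - u\<^sup>2) / (1 - 2 * u * cos (2 * pi * t) + u\<^sup>2)))
      has_integral H U) {0..1}"
  proof (rule has_integral_eq[OF _ int[unfolded gU]])
    fix t :: real assume t: "t \<in> {0..1}"
    define z where "z = cis (2 * pi * t)"
    have z: "circlepath 0 1 t = z" by (simp add: circlepath z_def cis_conv_exp mult_ac)
    have z1: "norm z = 1" by (simp add: z_def)
    then have zc: "z * cnj z = 1" by (simp add: complex_norm_square[symmetric])
    have vd: "vector_derivative (circlepath 0 1) (at t within {0..1}) = K * z"
      using t by (simp add: vector_derivative_circlepath01 z_def cis_conv_exp K_def mult_ac)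
    have "z - U = z * (1 - U * cnj z)" using zc by (simp add: algebra_simps)
    moreover have "z \<noteq> 0" using z1 by auto
    ultimately have "1 / K * (g z / (z - U) * (K * z))
        = H z * (1 - U\<^sup>2) / ((1 - U * z) * (1 - U * cnj z))"
      using K by (simp add: g_def)
    also have "(1 - U * z) * (1 - U * cnj z) = of_real (1 - 2 * u * Re z + u\<^sup>2)"
    proof -
      have "(1 - U * z) * (1 - U * cnj z) = 1 - U * (z + cnj z) + U\<^sup>2 * (z * cnj z)"
        by (simp add: algebra_simps power2_eq_square)
      also have "\<dots> = of_real (1 - 2 * u * Re z + u\<^sup>2)"
        by (simp add: zc complex_add_cnj U_def)
      finally show ?thesis .
    qed
    finally show "1 / K * (g (circlepath 0 1 t) / (circlepath 0 1 t - U)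
          * vector_derivative (circlepath 0 1) (at t within {0..1}))
        = H (cis (2 * pi * t)) * of_real ((1 - u\<^sup>2) / (1 - 2 * u * cos (2 * pi * t) + u\<^sup>2))"
      unfolding z vd by (simp add: U_def z_def)
  qed
  from has_integral_Re[OF this] show ?thesis
    by (simp add: U_def)
qed

text \<open>After multiplication by \<open>(1 + q)^2\<close>, numerator and denominator of the
  Poisson kernel become 4 times those of the half-line kernel, with
  \<open>y = (1 - C) / 2\<close>.\<close>

lemma cayley_kernel:
  fixes q C :: real
  assumes q: "0 < q"
  defines "u \<equiv> (1 - q) / (1 + q)"
  shows "(1 - u\<^sup>2) / (1 - 2 * u * C + u\<^sup>2) = half_line_kernel q ((1 - C) / 2)"
proof -
  have nz: "(1 + q)\<^sup>2 \<noteq> 0" using q by simp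
  have u2: "u\<^sup>2 = (1 - q)\<^sup>2 / (1 + q)\<^sup>2" by (simp add: u_def power_divide)
  have "1 - u\<^sup>2 = ((1 + q)\<^sup>2 - (1 - q)\<^sup>2) / (1 + q)\<^sup>2"
    by (simp only: diff_divide_distrib u2 divide_self[OF nz])
  also have "(1 + q)\<^sup>2 - (1 - q)\<^sup>2 = 4 * q"
    by (simp add: power2_eq_square algebra_simps)
  finally have 1: "1 - u\<^sup>2 = 4 * q / (1 + q)\<^sup>2" .
  have uq: "u = (1 - q) * (1 + q) / (1 + q)\<^sup>2" using q by (simp add: u_def power2_eq_square)
  have "1 - 2 * u * C + u\<^sup>2 = (1 + q)\<^sup>2 / (1 + q)\<^sup>2 - 2 * ((1 - q) * (1 + q) / (1 + q)\<^sup>2) * C + (1 - q)\<^sup>2 / (1 + q)\<^sup>2"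
    by (simp only: u2 divide_self[OF nz] uq[symmetric])
  also have "\<dots> = ((1 + q)\<^sup>2 - 2 * ((1 - q) * (1 + q)) * C + (1 - q)\<^sup>2) / (1 + q)\<^sup>2"
    by (simp add: add_divide_distrib diff_divide_distrib)
  also have "(1 + q)\<^sup>2 - 2 * ((1 - q) * (1 + q)) * C + (1 - q)\<^sup>2
      = 4 * ((1 - C) / 2 + q\<^sup>2 * (1 - (1 - C) / 2))"
    by (simp add: power2_eq_square field_simps)
  finally have 2: "1 - 2 * u * C + u\<^sup>2 = 4 * ((1 - C) / 2 + q\<^sup>2 * (1 - (1 - C) / 2)) / (1 + q)\<^sup>2" .
  have cancel: "4 * a / n / (4 * b / n) = a / b" if "n \<noteq> 0" for a b n :: real
    using that by simp
  show ?thesis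
    unfolding 1 2 half_line_kernel_def cancel[OF nz] by (rule refl)
qed

text \<open>The boundary values of \<open>Re H\<close>, divided by \<open>Re (H 0)\<close>, form a
  probability density on the circle; its mass is read off at \<open>q = 1\<close>, the centre of the
  disc. At a real point the kernel depends on the angle only through its cosine, so the measure is
  pushed forward to \<open>[0, 1]\<close>.\<close>

lemma kernel_representable_closed_disc:
  assumes H: "H holomorphic_on cball 0 1" and pos: "\<And>z. norm z \<le> 1 \<Longrightarrow> 0 < Re (H z)"
  shows "kernel_representable (\<lambda>q. Re (H (of_real ((1 - q) / (1 + q)))) / Re (H 0))"
proof -
  define d where "d t = indicator {0..1} t * (Re (H (cis (2 * pi * t))) / Re (H 0))" for t :: real
  define Y where "Y t = (1 - cos (2 * pi * t)) / 2" for t :: real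
  have H0: "0 < Re (H 0)" using pos by simp
  have Y: "0 \<le> Y t" "Y t \<le> 1" for t
    using cos_ge_minus_one[of "2 * pi * t"] cos_le_one[of "2 * pi * t"] by (auto simp: Y_def)
  have "continuous_on UNIV (\<lambda>t::real. H (cis (2 * pi * t)))"
    by (rule continuous_on_compose2[OF holomorphic_on_imp_continuous_on[OF H]])
      (auto intro!: continuous_intros)
  then have "continuous_on UNIV (\<lambda>t::real. Re (H (cis (2 * pi * t))))"
    by (intro continuous_intros)
  then have [measurable]: "(\<lambda>t::real. Re (H (cis (2 * pi * t)))) \<in> borel_measurable borel"
    by (rule borel_measurable_continuous_onI)
  have [measurable]: "d \<in> borel_measurable borel" "Y \<in> borel_measurable borel"
    unfolding d_def[abs_def] Y_def[abs_def] by measurable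
  have d: "0 \<le> d t" for t
    using pos[of "cis (2 * pi * t)"] H0 by (simp add: d_def indicator_def less_imp_le)
  have int: "has_bochner_integral lborel (\<lambda>t. d t * half_line_kernel q (Y t))
      (Re (H (of_real ((1 - q) / (1 + q)))) / Re (H 0))" if q: "0 < q" for q
  proof -
    define u where "u = (1 - q) / (1 + q)"
    have u: "- 1 < u" "u < 1" using q by (auto simp: u_def field_simps)
    let ?f = "\<lambda>t. Re (H (cis (2 * pi * t))) * half_line_kernel q (Y t) / Re (H 0)"
    have "((\<lambda>t. Re (H (cis (2 * pi * t))) * half_line_kernel q (Y t)) has_integral Re (H (of_real u))) {0..1}"
      using poisson_formula_real[OF H u] by (simp only: u_def cayley_kernel[OF q] Y_def)
    from has_integral_divide[OF this, of "Re (H 0)"]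
    have "(?f has_integral Re (H (of_real u)) / Re (H 0)) {0..1}" .
    then have "(\<integral>\<^sup>+t. ennreal (?f t) * indicator {0..1} t \<partial>lborel) = ennreal (Re (H (of_real u)) / Re (H 0))"
      by (rule nn_integral_has_integral_lebesgue'[rotated])
        (intro divide_nonneg_pos mult_nonneg_nonneg half_line_kernel_bounds(1)[OF Y q] H0 less_imp_le[OF pos], simp)
    moreover have "ennreal (?f t) * indicator {0..1} t = ennreal (d t * half_line_kernel q (Y t))" for t
      by (simp add: d_def split: split_indicator)
    ultimately have nn: "(\<integral>\<^sup>+t. ennreal (d t * half_line_kernel q (Y t)) \<partial>lborel) = ennreal (Re (H (of_real u)) / Re (H 0))"
      by simp
    have "0 < Re (H (of_real u))" using u by (intro pos) (simp add: abs_le_iff)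
    then have "0 \<le> Re (H (of_real u)) / Re (H 0)" using H0 by simp
    then show ?thesis
      using d half_line_kernel_bounds(1)[OF Y q] nn unfolding u_def
      by (intro has_bochner_integral_nn_integral) auto
  qed
  define P where "P = density lborel (\<lambda>t. ennreal (d t))"
  have [simp, measurable_cong]: "sets P = sets borel" by (simp add: P_def)
  have "has_bochner_integral lborel d 1"
    using int[of 1] H0 by (simp add: half_line_kernel_def)
  then have "(\<integral>\<^sup>+t. ennreal (d t) \<partial>lborel) = 1"
    using d by (subst nn_integral_eq_integral) (auto simp: has_bochner_integral_iff)
  then have P: "prob_space P"
    by (intro prob_spaceI) (simp add: P_def emeasure_density)
  then interpret P: prob_space P .
  define \<kappa> where "\<kappa> = distr P borel Y"
  have Ym: "Y \<in> measurable P borel" by measurable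
  have "real_distribution \<kappa>"
    unfolding \<kappa>_def by (rule P.real_distribution_distr) (rule Ym)
  moreover have "AE y in \<kappa>. 0 \<le> y \<and> y \<le> 1"
    unfolding \<kappa>_def using Y by (subst AE_distr_iff[OF Ym]) auto
  moreover have "Re (H (of_real ((1 - q) / (1 + q)))) / Re (H 0) = (LINT y|\<kappa>. half_line_kernel q y)"
    if q: "0 < q" for q
  proof -
    have "(LINT y|\<kappa>. half_line_kernel q y) = (LINT t|P. half_line_kernel q (Y t))"
      unfolding \<kappa>_def by (rule integral_distr[OF Ym]) measurable
    also have "\<dots> = (LINT t|lborel. d t * half_line_kernel q (Y t))"
      unfolding P_def using d by (subst integral_density) auto
    finally show ?thesis
      using int[OF q] by (simp add: has_bochner_integral_iff)
  qed
  ultimately show ?thesis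
    unfolding kernel_representable_def unit_interval_distribution_def by blast
qed

text \<open>Boundary values of \<open>H\<close> need not exist. The dilates
  \<open>H (r n * z)\<close> are holomorphic up to the circle and converge to \<open>H\<close> at
  each real point.\<close>

lemma kernel_representable_disc:
  assumes H: "H holomorphic_on ball 0 1" and pos: "\<And>z. norm z < 1 \<Longrightarrow> 0 < Re (H z)"
  shows "kernel_representable (\<lambda>q. Re (H (of_real ((1 - q) / (1 + q)))) / Re (H 0))"
proof -
  define r where "r n = 1 - inverse (real (Suc n))" for n
  have r: "0 \<le> r n" "r n < 1" for n by (auto simp: r_def field_simps)
  have rz: "norm (of_real (r n) * z) < 1" if "norm z \<le> 1" for n and z :: complex
    using that r[of n] by (simp add: norm_mult) (smt (verit) mult_left_le norm_ge_zero)
  define h where "h n q = Re (H (of_real (r n) * of_real ((1 - q) / (1 + q)))) / Re (H 0)" for n q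
  show ?thesis
  proof (rule kernel_representable_limit[where h = h])
    fix n
    have "(\<lambda>z. H (of_real (r n) * z)) holomorphic_on cball 0 1"
      by (rule holomorphic_on_compose_gen[OF _ H, unfolded o_def])
        (use rz in \<open>auto intro!: holomorphic_intros\<close>)
    from kernel_representable_closed_disc[OF this]
    show "kernel_representable (h n)"
      using pos rz by (simp add: h_def[abs_def])
  next
    fix q :: real assume q: "0 < q"
    define u where "u = (1 - q) / (1 + q)"
    have "- 1 < u" "u < 1" using q by (auto simp: u_def field_simps)
    then have "complex_of_real u \<in> ball 0 1" by (simp add: abs_less_iff)
    then have cont: "isCont H (of_real u)"
      using H holomorphic_on_imp_continuous_on continuous_on_eq_continuous_at open_ball by blast
    have "r \<longlonglongrightarrow> 1 - 0"
      unfolding r_def[abs_def] by (intro tendsto_intros LIMSEQ_inverse_real_of_nat)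
    then have "(\<lambda>n. of_real (r n) * complex_of_real u) \<longlonglongrightarrow> of_real (1 - 0) * of_real u"
      by (intro tendsto_intros)
    then have "(\<lambda>n. of_real (r n) * complex_of_real u) \<longlonglongrightarrow> of_real u" by simp
    from isCont_tendsto_compose[OF cont this]
    show "(\<lambda>n. h n q) \<longlonglongrightarrow> Re (H (of_real ((1 - q) / (1 + q)))) / Re (H 0)"
      unfolding h_def u_def[symmetric]
      using pos[of 0] by (intro tendsto_intros) auto
  qed
qed

lemma Re_cayley_pos:
  fixes u :: complex
  assumes "norm u < 1"
  shows "0 < Re ((1 - u) / (1 + u))" "1 + u \<noteq> 0"
proof -
  show nz: "1 + u \<noteq> 0"
    using assms by (metis add.commute add_eq_0_iff less_irrefl norm_minus_cancel norm_one)
  have "(norm u)\<^sup>2 < 1" using assms by (simp add: power_less_one_iff abs_square_less_1)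
  then have "0 < Re ((1 - u) * cnj (1 + u))"
    unfolding cmod_power2 by (simp add: power2_eq_square algebra_simps)
  moreover have "Re ((1 - u) / (1 + u)) = Re ((1 - u) * cnj (1 + u)) / (norm (1 + u))\<^sup>2"
    by (metis Re_complex_div_eq_0 complex_div_cnj Re_divide_of_real of_real_power)
  ultimately show "0 < Re ((1 - u) / (1 + u))" using nz by simp
qed

text \<open>The Cayley map \<open>(1 - u) / (1 + u)\<close> is its own inverse and exchanges the
  disc with the half-plane; the centre 0 corresponds to \<open>q = 1\<close>, whence the
  normalisation.\<close>

lemma kernel_representable_half_plane:
  assumes N: "N holomorphic_on {q. 0 < Re q}" and pos: "\<And>q. 0 < Re q \<Longrightarrow> 0 < Re (N q)"
  shows "kernel_representable (\<lambda>q. Re (N (of_real q)) / Re (N 1))"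
proof -
  let ?H = "\<lambda>u. N ((1 - u) / (1 + u))"
  have "?H holomorphic_on ball 0 1"
    by (rule holomorphic_on_compose_gen[OF _ N, unfolded o_def])
      (use Re_cayley_pos in \<open>auto intro!: holomorphic_intros\<close>)
  then have "kernel_representable (\<lambda>q. Re (?H (of_real ((1 - q) / (1 + q)))) / Re (?H 0))"
    using Re_cayley_pos(1) pos by (intro kernel_representable_disc) auto
  moreover have "(1 - complex_of_real ((1 - q) / (1 + q))) / (1 + of_real ((1 - q) / (1 + q))) = of_real q"
    if "0 < q" for q
  proof -
    have "(1 - (1 - q) / (1 + q)) / (1 + (1 - q) / (1 + q)) = q"
      using that by (simp add: field_simps)
    then show ?thesis by (metis of_real_1 of_real_add of_real_diff of_real_divide)
  qed
  ultimately show ?thesis by (simp add: kernel_representable_def)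
qed

section \<open>The square root of the free Poisson distribution\<close>

text \<open>For \<open>Re q > 0\<close> this is \<open>|Arg n| <= |Arg q|\<close> inside the right
  half-plane, with the comparison of slopes cleared of denominators. The sector is convex and
  symmetric about the real axis.\<close>

definition in_cone :: "complex \<Rightarrow> complex \<Rightarrow> bool" where
  "in_cone q n \<longleftrightarrow> 0 < Re n \<and> \<bar>Im n\<bar> * Re q \<le> \<bar>Im q\<bar> * Re n"

lemma in_cone_self: "0 < Re q \<Longrightarrow> in_cone q q"
  by (simp add: in_cone_def)

lemma in_cone_add:
  assumes "in_cone q m" "in_cone q n" "0 < Re q"
  shows "in_cone q (m + n)"
proof -
  have "\<bar>Im (m + n)\<bar> * Re q \<le> (\<bar>Im m\<bar> + \<bar>Im n\<bar>) * Re q"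
    using assms(3) by (intro mult_right_mono) auto
  also have "\<dots> \<le> \<bar>Im q\<bar> * Re (m + n)"
    using assms by (simp add: in_cone_def algebra_simps)
  finally show ?thesis using assms by (simp add: in_cone_def)
qed

lemma in_cone_inverse:
  assumes "in_cone q n"
  shows "in_cone q (1 / n)"
proof -
  have pos: "0 < (Re n)\<^sup>2 + (Im n)\<^sup>2"
    using assms by (intro add_pos_nonneg) (auto simp: in_cone_def)
  then show ?thesis
    using assms by (auto simp: in_cone_def Re_divide Im_divide intro!: divide_right_mono)
qed

text \<open>Applied with \<open>a = c - 1\<close>, which is nonnegative because
  \<open>c >= 1\<close>. For \<open>a = 0\<close> the first summand is 0, which is outside the cone,
  hence the case distinction.\<close>

lemma in_cone_scaled_add:
  assumes "in_cone q n" "0 < Re q" "0 \<le> a"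
  shows "in_cone q (of_real a * q + n)"
proof (cases "a = 0")
  case False
  then have "in_cone q (of_real a * q)"
    using assms by (simp add: in_cone_def abs_mult)
  then show ?thesis using assms by (intro in_cone_add)
qed (use assms in simp)

text \<open>The root is a geometric mean: its argument is the mean of those of \<open>q\<close> and
  \<open>n\<close>, so it stays in the sector, and the sum of the two arguments never reaches the
  cut. In the algebraic proof, \<open>k * Im p >= 0\<close> says that the root lies on the same side
  of the real axis as \<open>q\<close>, and \<open>k * I <= 0\<close> that it does not pass beyond
  \<open>q\<close>.\<close>

lemma in_cone_csqrt:
  assumes q: "0 < Re q" and n: "in_cone q n"
  shows "q * n \<notin> \<real>\<^sub>\<le>\<^sub>0" "in_cone q (csqrt (q * n))"
proof -
  define l k a b where "l = Re q" and "k = Im q" and "a = Re n" and "b = Im n"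
  have l: "0 < l" and a: "0 < a" and b: "\<bar>b\<bar> * l \<le> \<bar>k\<bar> * a"
    using q n by (auto simp: in_cone_def l_def k_def a_def b_def)
  have kb: "\<bar>k * (l * b)\<bar> \<le> k * (k * a)"
  proof -
    have "\<bar>k * (l * b)\<bar> = \<bar>k\<bar> * (\<bar>b\<bar> * l)" using l by (simp add: abs_mult)
    also have "\<dots> \<le> \<bar>k\<bar> * (\<bar>k\<bar> * a)" using b by (intro mult_left_mono) auto
    also have "\<dots> = k * (k * a)" by simp
    finally show ?thesis .
  qed
  have Re_qn: "Re (q * n) = l * a - k * b" and Im_qn: "Im (q * n) = l * b + k * a"
    by (auto simp: l_def k_def a_def b_def)
  show notin: "q * n \<notin> \<real>\<^sub>\<le>\<^sub>0"
  proof
    assume "q * n \<in> \<real>\<^sub>\<le>\<^sub>0"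
    then have 1: "l * b + k * a = 0" and 2: "l * a - k * b \<le> 0"
      unfolding complex_nonpos_Reals_iff Re_qn Im_qn by auto
    \<comment> \<open>On the cut the imaginary part of \<open>q * n\<close> vanishes; this identity
      then makes its real part positive.\<close>
    have "l * (l * a - k * b) = (l\<^sup>2 + k\<^sup>2) * a - k * (l * b + k * a)"
      by (simp add: power2_eq_square algebra_simps)
    also have "\<dots> > 0" unfolding 1 using l a by (simp add: add_pos_nonneg)
    finally show False using 2 l by (simp add: zero_less_mult_iff)
  qed
  define p where "p = csqrt (q * n)"
  have p2: "p\<^sup>2 = q * n" by (simp add: p_def)
  have Re_p: "0 < Re p"
  proof (rule ccontr)
    assume "\<not> 0 < Re p"
    then have "Re p = 0" using csqrt_principal[of "q * n"] by (auto simp: p_def)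
    then have "p\<^sup>2 \<in> \<real>\<^sub>\<le>\<^sub>0" by (simp add: complex_nonpos_Reals_iff power2_eq_square)
    then show False using notin p2 by simp
  qed
  have Im_p: "2 * (Re p * Im p) = l * b + k * a"
    using arg_cong[OF p2, of Im] unfolding Im_qn by (simp add: power2_eq_square mult.commute)
  have "0 \<le> k * (l * b + k * a)" using kb by (simp add: algebra_simps abs_le_iff)
  then have "0 \<le> Re p * (k * Im p)" unfolding Im_p[symmetric] by (simp add: algebra_simps)
  then have kp: "0 \<le> k * Im p" using Re_p by (simp add: zero_le_mult_iff)
  \<comment> \<open>Real and imaginary part of \<open>p * cnj q\<close>, whose argument is the
    difference of those of \<open>p\<close> and \<open>q\<close>. Its square is
    \<open>|q|^2 * n * cnj q\<close>, and this brings in the cone condition on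
    \<open>n\<close>.\<close>
  define R I where "R = Re p * l + Im p * k" and "I = Im p * l - Re p * k"
  have "(p * cnj q)\<^sup>2 = p\<^sup>2 * (cnj q)\<^sup>2" by (simp add: power_mult_distrib)
  also have "\<dots> = (q * cnj q) * (n * cnj q)" unfolding p2 by (simp add: power2_eq_square)
  also have "\<dots> = of_real (l\<^sup>2 + k\<^sup>2) * (n * cnj q)"
    by (simp add: complex_mult_cnj l_def k_def)
  finally have "Im ((p * cnj q)\<^sup>2) = (l\<^sup>2 + k\<^sup>2) * (l * b - k * a)"
    by (simp add: l_def k_def a_def b_def algebra_simps)
  moreover have "Im ((p * cnj q)\<^sup>2) = 2 * (R * I)"
    by (simp add: power2_eq_square R_def I_def l_def k_def algebra_simps)
  ultimately have RI: "2 * (R * I) = (l\<^sup>2 + k\<^sup>2) * (l * b - k * a)"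
    by simp
  have "2 * R * (k * I) = k * (2 * (R * I))" by simp
  also have "\<dots> = (l\<^sup>2 + k\<^sup>2) * (k * (l * b) - k * (k * a))"
    unfolding RI by (simp add: algebra_simps)
  also have "\<dots> \<le> 0"
    using kb by (intro mult_nonneg_nonpos) (auto simp: abs_le_iff)
  finally have "2 * R * (k * I) \<le> 0" .
  moreover have "0 < R" unfolding R_def using Re_p l kp by (intro add_pos_nonneg) (auto simp: mult.commute)
  ultimately have kI: "k * I \<le> 0" by (simp add: mult_le_0_iff)
  have "\<bar>Im p\<bar> * l \<le> \<bar>k\<bar> * Re p"
  proof (cases "k = 0")
    case True
    then have "b = 0" using b l by (simp add: mult_le_0_iff)
    then show ?thesis using Im_p Re_p True by simp
  next
    case False
    have "\<bar>k\<bar> * (\<bar>Im p\<bar> * l) = (k * Im p) * l" using kp by (simp add: abs_mult[symmetric])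
    also have "\<dots> \<le> k * k * Re p" using kI by (simp add: I_def algebra_simps)
    also have "\<dots> = \<bar>k\<bar> * (\<bar>k\<bar> * Re p)" by simp
    finally show ?thesis using False by simp
  qed
  then show "in_cone q (csqrt (q * n))"
    using Re_p by (simp add: in_cone_def p_def l_def k_def)
qed

(* With z = - q^2 these are the iterates of v = sqrt (c - 1 + 1 / (1 - z v)), multiplied by q. *)
primrec sqrt_iterate :: "real \<Rightarrow> nat \<Rightarrow> complex \<Rightarrow> complex" where
  "sqrt_iterate c 0 q = q"
| "sqrt_iterate c (Suc k) q =
     csqrt (q * (of_real (c - 1) * q + 1 / (1 / q + sqrt_iterate c k q)))"

lemma sqrt_iterate_in_cone:
  assumes "1 \<le> c" "0 < Re q"
  shows "in_cone q (sqrt_iterate c k q)"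
proof (induction k)
  case 0
  then show ?case using assms by (simp add: in_cone_self)
next
  case (Suc k)
  have "in_cone q (1 / (1 / q + sqrt_iterate c k q))"
    using assms Suc by (intro in_cone_inverse in_cone_add in_cone_self)
  then show ?case
    unfolding sqrt_iterate.simps using assms by (intro in_cone_csqrt in_cone_scaled_add) auto
qed

text \<open>Writing the iterate as \<open>q v\<close>, this number is
  \<open>q / (1 + q^2 v)\<close>, the candidate for \<open>q M\<close>. Lying in the cone, it has
  positive real part, which is what the Herglotz representation asks for.\<close>

lemma in_cone_resolvent:
  assumes "1 \<le> c" "0 < Re q"
  shows "in_cone q (1 / (1 / q + sqrt_iterate c k q))"
  using assms by (intro in_cone_inverse in_cone_add in_cone_self sqrt_iterate_in_cone)

lemma sqrt_iterate_holomorphic: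
  assumes c: "1 \<le> c"
  shows "sqrt_iterate c k holomorphic_on {q. 0 < Re q}"
    "(\<lambda>q. 1 / (1 / q + sqrt_iterate c k q)) holomorphic_on {q. 0 < Re q}"
proof -
  have nz: "1 / q + sqrt_iterate c j q \<noteq> 0" if "0 < Re q" for q j
    using in_cone_resolvent[OF c that, of j] by (auto simp: in_cone_def)
  have step: "(\<lambda>q. 1 / (1 / q + sqrt_iterate c j q)) holomorphic_on {q. 0 < Re q}"
    if "sqrt_iterate c j holomorphic_on {q. 0 < Re q}" for j
    using that nz by (intro holomorphic_intros) auto
  show "sqrt_iterate c k holomorphic_on {q. 0 < Re q}"
  proof (induction k)
    case 0
    have "sqrt_iterate c 0 = (\<lambda>q. q)" by auto
    then show ?case by simp
  next
    case (Suc k)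
    have "(\<lambda>q. q * (of_real (c - 1) * q + 1 / (1 / q + sqrt_iterate c k q))) holomorphic_on {q. 0 < Re q}"
      by (intro holomorphic_intros step Suc)
    moreover have "q * (of_real (c - 1) * q + 1 / (1 / q + sqrt_iterate c k q)) \<notin> \<real>\<^sub>\<le>\<^sub>0" if "0 < Re q" for q
      using c that by (intro in_cone_csqrt(1) in_cone_scaled_add in_cone_resolvent) auto
    ultimately have "(\<lambda>q. csqrt (q * (of_real (c - 1) * q + 1 / (1 / q + sqrt_iterate c k q)))) holomorphic_on {q. 0 < Re q}"
      by (intro holomorphic_on_csqrt') auto
    then show ?case by (simp only: sqrt_iterate.simps(2)[abs_def])
  qed
  from step[OF this] show "(\<lambda>q. 1 / (1 / q + sqrt_iterate c k q)) holomorphic_on {q. 0 < Re q}" .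
qed

section \<open>The iteration on the positive axis and its limit\<close>

primrec real_iterate :: "real \<Rightarrow> real \<Rightarrow> nat \<Rightarrow> real" where
  "real_iterate c t 0 = 1"
| "real_iterate c t (Suc k) = sqrt (c - 1 + 1 / (1 + t * real_iterate c t k))"

lemma real_iterate_pos:
  assumes "1 \<le> c" "0 < t"
  shows "0 < real_iterate c t k"
proof (induction k)
  case (Suc k)
  then have "0 < 1 / (1 + t * real_iterate c t k)"
    using assms by (intro divide_pos_pos add_pos_pos mult_pos_pos) auto
  then have "0 < c - 1 + 1 / (1 + t * real_iterate c t k)"
    using assms by (intro add_nonneg_pos) auto
  then show ?case by (simp only: real_iterate.simps real_sqrt_gt_0_iff)
qed simp

lemma sqrt_iterate_of_real:
  assumes c: "1 \<le> c" and q: "0 < q"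
  shows "sqrt_iterate c k (of_real q) = of_real (q * real_iterate c (q\<^sup>2) k)"
    "1 / (1 / of_real q + sqrt_iterate c k (of_real q)) = of_real (q / (1 + q\<^sup>2 * real_iterate c (q\<^sup>2) k))"
proof -
  have step: "1 / (1 / of_real q + sqrt_iterate c j (of_real q)) = of_real (q / (1 + q\<^sup>2 * real_iterate c (q\<^sup>2) j))"
    if "sqrt_iterate c j (of_real q) = of_real (q * real_iterate c (q\<^sup>2) j)" for j
  proof -
    have "1 / (1 / q + q * v) = q / (1 + q\<^sup>2 * v)" for v
    proof -
      have "1 / q + q * v = (1 + q\<^sup>2 * v) / q" using q by (simp add: field_simps power2_eq_square)
      then show ?thesis by simp
    qed
    from arg_cong[OF this, of complex_of_real] show ?thesis
      unfolding that by (simp only: of_real_divide of_real_add of_real_1)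
  qed
  show "sqrt_iterate c k (of_real q) = of_real (q * real_iterate c (q\<^sup>2) k)"
  proof (induction k)
    case 0
    show ?case by simp
  next
    case (Suc k)
    define m where "m = 1 / (1 + q\<^sup>2 * real_iterate c (q\<^sup>2) k)"
    have "0 < m"
      unfolding m_def using q real_iterate_pos[OF c, of "q\<^sup>2" k]
      by (intro divide_pos_pos add_pos_pos mult_pos_pos) auto
    then have nn: "0 \<le> c - 1 + m" using c by simp
    have "of_real q * (of_real (c - 1) * of_real q + 1 / (1 / of_real q + sqrt_iterate c k (of_real q)))
        = complex_of_real (q\<^sup>2 * (c - 1 + m))"
      unfolding step[OF Suc] by (simp add: m_def power2_eq_square algebra_simps)
    then have "sqrt_iterate c (Suc k) (of_real q) = csqrt (of_real (q\<^sup>2 * (c - 1 + m)))"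
      by (simp only: sqrt_iterate.simps)
    also have "\<dots> = of_real (sqrt (q\<^sup>2 * (c - 1 + m)))"
      using nn by (subst of_real_sqrt) auto
    also have "sqrt (q\<^sup>2 * (c - 1 + m)) = q * real_iterate c (q\<^sup>2) (Suc k)"
      using q by (simp add: real_sqrt_mult m_def)
    finally show ?case .
  qed
  from step[OF this]
  show "1 / (1 / of_real q + sqrt_iterate c k (of_real q)) = of_real (q / (1 + q\<^sup>2 * real_iterate c (q\<^sup>2) k))" .
qed

lemma fixed_point_exists:
  assumes c: "1 \<le> c" and t: "0 < t"
  shows "\<exists>M::real. 0 < M \<and> M * (1 + t * sqrt (c - 1 + M)) = 1"
proof -
  have "\<exists>M. 0 \<le> M \<and> M \<le> 1 \<and> M * (1 + t * sqrt (c - 1 + M)) = 1"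
    \<comment> \<open>The left-hand side is 0 at \<open>M = 0\<close> and
      \<open>1 + t sqrt c\<close> at \<open>M = 1\<close>.\<close>
    by (rule IVT') (use c t in \<open>auto intro!: continuous_intros\<close>)
  then obtain M where "0 \<le> M" "M * (1 + t * sqrt (c - 1 + M)) = 1" by blast
  moreover from this have "M \<noteq> 0" by auto
  ultimately show ?thesis by (intro exI[of _ M]) simp
qed

lemma fixed_point_unique:
  fixes M N :: real
  assumes c: "1 \<le> c" and t: "0 < t"
    and M: "0 < M" "M * (1 + t * sqrt (c - 1 + M)) = 1"
    and N: "0 < N" "N * (1 + t * sqrt (c - 1 + N)) = 1"
  shows "M = N"
proof -
  have less: "M' * (1 + t * sqrt (c - 1 + M')) < N' * (1 + t * sqrt (c - 1 + N'))"
    if "0 < M'" "M' < N'" for M' N' :: real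
  proof -
    have "0 \<le> c - 1 + M'" using that c by simp
    then show ?thesis
      using that t by (intro mult_strict_mono add_strict_left_mono mult_strict_left_mono) (auto intro!: add_pos_nonneg)
  qed
  show ?thesis using less[of M N] less[of N M] M N by linarith
qed

(* The logarithmic distance to the fixed point is halved by each square root. *)
lemma real_iterate_bounds:
  assumes c: "1 \<le> c" and t: "0 < t" and M: "0 < M" "M * (1 + t * sqrt (c - 1 + M)) = 1"
  defines "v \<equiv> sqrt (c - 1 + M)"
  shows "exp (- (\<bar>ln v\<bar> / 2 ^ k)) * v \<le> real_iterate c t k"
    "real_iterate c t k \<le> exp (\<bar>ln v\<bar> / 2 ^ k) * v"
proof -
  have v: "0 < v" using c M by (simp add: v_def)
  have v2: "v\<^sup>2 = c - 1 + M" using c M by (simp add: v_def)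
  have "0 < 1 + t * v" using t v by (intro add_pos_pos mult_pos_pos) auto
  then have Mv: "M = 1 / (1 + t * v)"
    using M by (simp add: v_def[symmetric] eq_divide_eq)
  have "exp (- (\<bar>ln v\<bar> / 2 ^ k)) * v \<le> real_iterate c t k \<and> real_iterate c t k \<le> exp (\<bar>ln v\<bar> / 2 ^ k) * v"
  proof (induction k)
    case 0
    \<comment> \<open>The iteration starts at 1, so \<open>|ln v|\<close> is the initial logarithmic
      distance to the fixed point \<open>v\<close>.\<close>
    have "exp (- \<bar>ln v\<bar>) * v = exp (- \<bar>ln v\<bar> + ln v)" "exp \<bar>ln v\<bar> * v = exp (\<bar>ln v\<bar> + ln v)"
      unfolding exp_add using v by simp_all
    moreover have "exp (- \<bar>ln v\<bar> + ln v) \<le> 1" "1 \<le> exp (\<bar>ln v\<bar> + ln v)"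
      by (simp_all only: exp_le_one_iff one_le_exp_iff)
    ultimately show ?case by simp
  next
    case (Suc k)
    define L where "L = exp (\<bar>ln v\<bar> / 2 ^ k)"
    define x where "x = real_iterate c t k"
    define s where "s = exp (\<bar>ln v\<bar> / 2 ^ Suc k)"
    have L: "1 \<le> L" by (simp add: L_def)
    have s: "0 < s" "s\<^sup>2 = L" by (auto simp: s_def L_def power2_eq_square simp flip: exp_add)
    have x: "0 < x" unfolding x_def by (rule real_iterate_pos[OF c t])
    have x1: "v / L \<le> x" and x2: "x \<le> L * v"
      using Suc by (auto simp: x_def L_def exp_minus divide_inverse mult.commute)
    \<comment> \<open>The map \<open>1 / (1 + t x)\<close> does not enlarge a ratio
      \<open>L >= 1\<close>, since the summand 1 is itself at most \<open>L\<close>.\<close>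
    have 1: "M / L \<le> 1 / (1 + t * x)"
    proof -
      have "1 + t * x \<le> L + t * (L * v)"
        using L x2 t by (intro add_mono mult_left_mono) auto
      also have "\<dots> = L * (1 + t * v)" by (simp add: algebra_simps)
      finally have "1 / (L * (1 + t * v)) \<le> 1 / (1 + t * x)"
        using x t by (intro frac_le) (auto intro!: add_pos_pos)
      then show ?thesis by (simp add: Mv mult.commute)
    qed
    have 2: "1 / (1 + t * x) \<le> L * M"
    proof -
      have "v \<le> L * x" using x1 L by (simp add: divide_le_eq mult.commute)
      then have "1 + t * v \<le> L + t * (L * x)"
        using L t by (intro add_mono mult_left_mono) auto
      also have "\<dots> = L * (1 + t * x)" by (simp add: algebra_simps)
      finally have "1 / (L * (1 + t * x)) \<le> M"
        unfolding Mv using v t by (intro frac_le) (auto intro!: add_pos_pos)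
      then have "1 / (1 + t * x) / L \<le> M" by (simp add: mult.commute)
      then have "1 / (1 + t * x) \<le> M * L"
        using L by (subst (asm) pos_divide_le_eq) auto
      then show ?thesis by (simp only: mult.commute)
    qed
    \<comment> \<open>Adding \<open>c - 1 >= 0\<close> keeps the ratio within \<open>L\<close>, and
      the root replaces \<open>L\<close> by \<open>s\<close>, its square root.\<close>
    have "(v / s)\<^sup>2 \<le> c - 1 + 1 / (1 + t * x)"
    proof -
      have "(v / s)\<^sup>2 = (c - 1) / L + M / L" by (simp add: power_divide v2 s add_divide_distrib)
      also have "(c - 1) / L \<le> c - 1" using c L mult_left_mono[OF L, of "c - 1"] by (simp add: divide_le_eq)
      finally show ?thesis using 1 by simp
    qed
    then have "v / s \<le> real_iterate c t (Suc k)" by (simp add: x_def real_le_rsqrt)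
    moreover have "c - 1 + 1 / (1 + t * x) \<le> (s * v)\<^sup>2"
    proof -
      have "c - 1 \<le> L * (c - 1)" using c mult_right_mono[OF L, of "c - 1"] by simp
      moreover have "(s * v)\<^sup>2 = L * (c - 1) + L * M" by (simp add: power_mult_distrib v2 s algebra_simps)
      ultimately show ?thesis using 2 by simp
    qed
    then have "real_iterate c t (Suc k) \<le> s * v"
      using s v by (simp add: x_def real_le_lsqrt)
    moreover have "exp (- (\<bar>ln v\<bar> / 2 ^ Suc k)) * v = v / s"
      unfolding s_def exp_minus divide_inverse[of v] by (rule mult.commute)
    ultimately show ?case
      unfolding s_def[symmetric] by (simp only:)
  qed
  then show "exp (- (\<bar>ln v\<bar> / 2 ^ k)) * v \<le> real_iterate c t k"
    "real_iterate c t k \<le> exp (\<bar>ln v\<bar> / 2 ^ k) * v" by auto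
qed

lemma real_iterate_tendsto:
  assumes c: "1 \<le> c" and t: "0 < t" and M: "0 < M" "M * (1 + t * sqrt (c - 1 + M)) = 1"
  shows "(\<lambda>k. 1 / (1 + t * real_iterate c t k)) \<longlonglongrightarrow> M"
proof -
  define v where "v = sqrt (c - 1 + M)"
  have v: "0 < v" using c M by (simp add: v_def)
  have "(\<lambda>k. \<bar>ln v\<bar> / 2 ^ k) \<longlonglongrightarrow> 0"
    using tendsto_mult_right_zero[OF LIMSEQ_inverse_realpow_zero[of 2], of "\<bar>ln v\<bar>"]
    by (simp add: divide_inverse)
  then have "(\<lambda>k. exp (- (\<bar>ln v\<bar> / 2 ^ k)) * v) \<longlonglongrightarrow> exp (- 0) * v"
    "(\<lambda>k. exp (\<bar>ln v\<bar> / 2 ^ k) * v) \<longlonglongrightarrow> exp 0 * v"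
    by (intro tendsto_intros; simp)+
  then have "(\<lambda>k. exp (- (\<bar>ln v\<bar> / 2 ^ k)) * v) \<longlonglongrightarrow> v" "(\<lambda>k. exp (\<bar>ln v\<bar> / 2 ^ k) * v) \<longlonglongrightarrow> v"
    by simp_all
  then have "(\<lambda>k. real_iterate c t k) \<longlonglongrightarrow> v"
    by (rule tendsto_sandwich[rotated 2])
      (use real_iterate_bounds[OF c t M] in \<open>auto simp: v_def\<close>)
  moreover have nz: "0 < 1 + t * v" using t v by (intro add_pos_pos mult_pos_pos) auto
  ultimately have "(\<lambda>k. 1 / (1 + t * real_iterate c t k)) \<longlonglongrightarrow> 1 / (1 + t * v)"
    by (intro tendsto_intros) auto
  moreover have "1 / (1 + t * v) = M"
    using M nz by (simp add: v_def[symmetric] divide_eq_eq)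
  ultimately show ?thesis by simp
qed

lemma kernel_representable_fixed_point:
  assumes c: "1 \<le> c"
    and m: "\<And>t. 0 < t \<Longrightarrow> 0 < m t \<and> m t * (1 + t * sqrt (c - 1 + m t)) = 1"
  shows "kernel_representable (\<lambda>q. q * m (q\<^sup>2) / m 1)"
proof -
  define N where "N k q = 1 / (1 / q + sqrt_iterate c k q)" for k q
  show ?thesis
  proof (rule kernel_representable_limit)
    fix k
    show "kernel_representable (\<lambda>q. Re (N k (of_real q)) / Re (N k 1))"
      using sqrt_iterate_holomorphic(2)[OF c] in_cone_resolvent[OF c]
      by (intro kernel_representable_half_plane) (auto simp: N_def[abs_def] in_cone_def)
  next
    fix q :: real assume q: "0 < q"
    have Re: "Re (N k (of_real q')) = q' * (1 / (1 + q'\<^sup>2 * real_iterate c (q'\<^sup>2) k))" if "0 < q'" for q' k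
      using sqrt_iterate_of_real(2)[OF c that, of k] by (simp add: N_def)
    have lim: "(\<lambda>k. Re (N k (of_real q'))) \<longlonglongrightarrow> q' * m (q'\<^sup>2)" if "0 < q'" for q'
      unfolding Re[OF that] using m[of "q'\<^sup>2"] that
      by (intro tendsto_intros real_iterate_tendsto c) auto
    show "(\<lambda>k. Re (N k (of_real q)) / Re (N k 1)) \<longlonglongrightarrow> q * m (q\<^sup>2) / m 1"
      using lim[OF q] lim[of 1] m[of 1] by (intro tendsto_divide) auto
  qed
qed

text \<open>Both bounds come from \<open>1 - M = M t sqrt (c - 1 + M)\<close>. The upper one will
  exclude mass at infinity; together they give \<open>M = 1\<close> in the limit
  \<open>t = 0\<close>, the total mass of the measure sought.\<close>

lemma fixed_point_near_1:
  assumes c: "1 \<le> c" and t: "0 < t" and M: "0 < M" "M * (1 + t * sqrt (c - 1 + M)) = 1"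
  shows "M \<le> 1" "1 - t * sqrt c \<le> M"
proof -
  have s: "0 \<le> sqrt (c - 1 + M)" using c M by simp
  have e: "1 - M = M * (t * sqrt (c - 1 + M))" using M(2) by (simp add: algebra_simps)
  also have "\<dots> \<ge> 0" using M t s by simp
  finally show le1: "M \<le> 1" by simp
  have "M * (t * sqrt (c - 1 + M)) \<le> 1 * (t * sqrt c)"
    using le1 M t s by (intro mult_mono mult_left_mono) auto
  then show "1 - t * sqrt c \<le> M" using e by simp
qed

(* If the representing measure of M charged 0, then M t would be unbounded near t = 0; so it can be
   transported to the half-line by x = (1 - y) / y, and M 0 = 1 makes the result a probability. *)
lemma ex_sqrt_distribution:
  assumes c: "1 \<le> c"
  obtains \<rho> where "nonneg_distribution \<rho>"
    "\<And>t M. 0 < t \<Longrightarrow> 0 < M \<Longrightarrow> M * (1 + t * sqrt (c - 1 + M)) = 1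
      \<Longrightarrow> Psi \<rho> (- complex_of_real t) = of_real (M - 1)"
proof -
  obtain m where m: "\<And>t. 0 < t \<Longrightarrow> 0 < m t \<and> m t * (1 + t * sqrt (c - 1 + m t)) = 1"
    using fixed_point_exists[OF c] by metis
  define K where "K t y = 1 / (y + t * (1 - y))" for t y :: real
  obtain \<kappa> where \<kappa>: "unit_interval_distribution \<kappa>"
    and rep: "\<And>q. 0 < q \<Longrightarrow> q * m (q\<^sup>2) / m 1 = (LINT y|\<kappa>. half_line_kernel q y)"
    using kernel_representable_fixed_point[of c m, OF c m] unfolding kernel_representable_def by blast
  interpret \<kappa>: real_distribution \<kappa> using \<kappa> by (simp add: unit_interval_distribution_def)
  have AE: "AE y in \<kappa>. 0 \<le> y \<and> y \<le> 1" using \<kappa> by (simp add: unit_interval_distribution_def)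
  have m1: "0 < m 1" using m by simp
  have [measurable]: "K t \<in> borel_measurable borel" for t unfolding K_def[abs_def] by measurable
  have K: "0 < K t y" if "0 < t" "0 \<le> y" "y \<le> 1" for t y
    unfolding K_def using that by (cases "y = 1") (auto intro!: divide_pos_pos add_nonneg_pos)
  have intK: "(LINT y|\<kappa>. K t y) = m t / m 1" if t: "0 < t" for t
  proof -
    have "half_line_kernel (sqrt t) y = sqrt t * K t y" for y
      using t by (simp add: half_line_kernel_def K_def)
    then have "sqrt t * (LINT y|\<kappa>. K t y) = sqrt t * (m t / m 1)"
      using rep[of "sqrt t"] t by simp
    then show ?thesis using t by (subst (asm) mult_cancel_left) auto
  qed
  have integrableK: "integrable \<kappa> (K t)" if t: "0 < t" for t
    \<comment> \<open>A function that is not integrable has integral 0 by convention, whereas this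
      integral is positive.\<close>
    using intK[OF t] m[OF t] m1 not_integrable_integral_eq by fastforce
  have m_near_1: "m t \<le> 1" "1 - t * sqrt c \<le> m t" if "0 < t" for t
    using fixed_point_near_1[OF c that] m[OF that] by auto

  have "measure \<kappa> {0} = 0"
  proof -
    have "measure \<kappa> {0} \<le> t / m 1" if t: "0 < t" for t
    proof -
      have "measure \<kappa> {0} / t = (LINT y|\<kappa>. indicator {0} y / t)" by simp
      also have "\<dots> \<le> (LINT y|\<kappa>. K t y)"
      proof (rule integral_mono_AE)
        show "AE y in \<kappa>. indicator {0} y / t \<le> K t y"
          using AE
        proof eventually_elim
          case (elim y)
          then show ?case using K[OF t, of y] by (cases "y = 0") (auto simp: K_def)
        qed
      qed (auto intro!: integrableK t integrable_divide \<kappa>.integrable_const_bound[where B = 1])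
      also have "\<dots> \<le> 1 / m 1" using intK[OF t] m_near_1[OF t] m1 by (simp add: divide_right_mono)
      finally show ?thesis using t by (simp add: divide_le_eq)
    qed
    \<comment> \<open>For this \<open>t\<close> the bound reads: the mass at 0 is at most half of
      itself.\<close>
    from this[of "measure \<kappa> {0} * m 1 / 2"] show ?thesis
      using m1 measure_nonneg[of \<kappa> "{0}"] by (cases "measure \<kappa> {0} = 0") auto
  qed
  then have "emeasure \<kappa> {0} = 0" by (simp add: \<kappa>.emeasure_eq_measure)
  then have "AE y in \<kappa>. y \<noteq> 0" by (intro AE_I[of _ _ "{0}"]) auto
  with AE have AE: "AE y in \<kappa>. 0 < y \<and> y \<le> 1" by eventually_elim auto

  define D where "D y = indicator {0<..1} y / y" for y :: real
  have [measurable]: "D \<in> borel_measurable borel" unfolding D_def[abs_def] by measurable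
  have D: "0 \<le> D y" for y by (simp add: D_def indicator_def)
  define tn where "tn n = inverse (real (Suc n))" for n
  have tn: "0 < tn n" for n by (simp add: tn_def)
  have tn0: "tn \<longlonglongrightarrow> 0" unfolding tn_def[abs_def] by (rule LIMSEQ_inverse_real_of_nat)
  \<comment> \<open>As \<open>t\<close> decreases to 0, \<open>K t y\<close> increases to
    \<open>1 / y\<close>; monotone convergence therefore computes the integral of
    \<open>1 / y\<close> as the limit of \<open>m t / m 1\<close>.\<close>
  have "(\<lambda>n. \<integral>\<^sup>+y. ennreal (indicator {0<..1} y * K (tn n) y) \<partial>\<kappa>) \<longlonglongrightarrow> (\<integral>\<^sup>+y. ennreal (D y) \<partial>\<kappa>)"
  proof (rule nn_integral_LIMSEQ)
    show "incseq (\<lambda>n y. ennreal (indicator {0<..1} y * K (tn n) y))"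
    proof (rule incseq_SucI, rule le_funI, rule ennreal_leI)
      fix n y
      show "indicator {0<..1} y * K (tn n) y \<le> indicator {0<..1} y * K (tn (Suc n)) y"
      proof (cases "y \<in> {0<..1}")
        case True
        have "tn (Suc n) \<le> tn n" by (simp add: tn_def field_simps)
        then have "y + tn (Suc n) * (1 - y) \<le> y + tn n * (1 - y)"
          using True by (intro add_left_mono mult_right_mono) auto
        moreover have "0 < y + tn k * (1 - y)" for k
          using True tn[of k] by (intro add_pos_nonneg) auto
        ultimately show ?thesis
          using True by (simp add: K_def divide_left_mono)
      qed simp
    qed
    fix y
    show "(\<lambda>n. ennreal (indicator {0<..1} y * K (tn n) y)) \<longlonglongrightarrow> ennreal (D y)"
    proof (cases "y \<in> {0<..1}")
      case True
      then have "(\<lambda>n. K (tn n) y) \<longlonglongrightarrow> 1 / (y + 0 * (1 - y))"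
        unfolding K_def by (intro tendsto_intros tn0) auto
      then show ?thesis using True by (simp add: D_def)
    qed (simp add: D_def)
  qed measurable
  moreover have "(\<integral>\<^sup>+y. ennreal (indicator {0<..1} y * K (tn n) y) \<partial>\<kappa>) = ennreal (m (tn n) / m 1)" for n
  proof -
    have "(\<integral>\<^sup>+y. ennreal (indicator {0<..1} y * K (tn n) y) \<partial>\<kappa>) = (\<integral>\<^sup>+y. ennreal (K (tn n) y) \<partial>\<kappa>)"
      by (rule nn_integral_cong_AE) (use AE in eventually_elim, simp)
    also have "\<dots> = ennreal (m (tn n) / m 1)"
      using integrableK[OF tn] intK[OF tn] K[OF tn]
      by (subst nn_integral_eq_integral) (auto intro!: eventually_mono[OF AE] less_imp_le)
    finally show ?thesis .
  qed
  moreover have "(\<lambda>n. ennreal (m (tn n) / m 1)) \<longlonglongrightarrow> ennreal (1 / m 1)"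
  proof -
    have "(\<lambda>n. 1 - tn n * sqrt c) \<longlonglongrightarrow> 1 - 0 * sqrt c" by (intro tendsto_intros tn0)
    then have lower: "(\<lambda>n. 1 - tn n * sqrt c) \<longlonglongrightarrow> 1" by simp
    have "(\<lambda>n. m (tn n)) \<longlonglongrightarrow> 1"
      by (rule tendsto_sandwich[OF _ _ lower tendsto_const]) (simp_all add: m_near_1[OF tn])
    then have "(\<lambda>n. m (tn n) / m 1) \<longlonglongrightarrow> 1 / m 1"
      using m1 by (intro tendsto_divide tendsto_const) auto
    then show ?thesis by (rule tendsto_ennrealI)
  qed
  ultimately have intD: "(\<integral>\<^sup>+y. ennreal (D y) \<partial>\<kappa>) = ennreal (1 / m 1)"
    by (auto intro: LIMSEQ_unique)

  \<comment> \<open>The weight \<open>1 / y\<close> converts the kernel: \<open>K t y\<close> is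
    \<open>1 / y\<close> times \<open>1 / (1 + t x)\<close> at \<open>x = (1 - y) / y\<close>. The
    factor \<open>m 1\<close> normalises the mass.\<close>
  define P where "P = density \<kappa> (\<lambda>y. ennreal (m 1 * D y))"
  have [simp, measurable_cong]: "sets P = sets borel" by (simp add: P_def)
  have "(\<integral>\<^sup>+y. ennreal (m 1 * D y) \<partial>\<kappa>) = ennreal (m 1) * (\<integral>\<^sup>+y. ennreal (D y) \<partial>\<kappa>)"
    using m1 D by (subst nn_integral_cmult[symmetric]) (auto simp: ennreal_mult)
  also have "\<dots> = 1" unfolding intD using m1 by (simp flip: ennreal_mult)
  finally have "prob_space P"
    by (intro prob_spaceI) (simp add: P_def emeasure_density)
  then interpret P: prob_space P .
  define X where "X y = (1 - y) / y" for y :: real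
  have Xm [measurable]: "X \<in> measurable P borel" unfolding X_def[abs_def] by measurable
  define \<rho> where "\<rho> = distr P borel X"
  have "AE y in P. 0 \<le> X y"
    unfolding P_def by (subst AE_density) (auto simp: D_def X_def indicator_def intro!: AE_I2)
  then have "AE x in \<rho>. 0 \<le> x"
    unfolding \<rho>_def by (subst AE_distr_iff[OF Xm]) auto
  moreover have "real_distribution \<rho>"
    unfolding \<rho>_def by (rule P.real_distribution_distr) (rule Xm)
  ultimately have \<rho>: "nonneg_distribution \<rho>"
    by (simp add: nonneg_distribution_def nonneg_distribution_axioms_def)
  show thesis
  proof (rule that[OF \<rho>])
    fix t M :: real
    assume t: "0 < t" and M: "0 < M" "M * (1 + t * sqrt (c - 1 + M)) = 1"
    interpret \<rho>: nonneg_distribution \<rho> by (rule \<rho>)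
    have mt: "m t = M" using fixed_point_unique[OF c t] m[OF t] M by blast
    have "(LINT x|\<rho>. 1 / (1 - - complex_of_real t * complex_of_real x))
        = (LINT x|\<rho>. complex_of_real (1 / (1 + t * x)))"
      by simp
    also have "\<dots> = of_real (LINT x|\<rho>. 1 / (1 + t * x))" by (rule integral_complex_of_real)
    also have "(LINT x|\<rho>. 1 / (1 + t * x)) = (LINT y|P. 1 / (1 + t * X y))"
      unfolding \<rho>_def by (rule integral_distr[OF Xm]) measurable
    also have "\<dots> = (LINT y|\<kappa>. m 1 * D y * (1 / (1 + t * X y)))"
      unfolding P_def using m1 D
      by (subst integral_density) (auto simp: X_def[abs_def])
    also have "\<dots> = (LINT y|\<kappa>. m 1 * K t y)"
    proof (rule integral_cong_AE)
      show "AE y in \<kappa>. m 1 * D y * (1 / (1 + t * X y)) = m 1 * K t y"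
        using AE
      proof eventually_elim
        case (elim y)
        have "1 + t * X y = (y + t * (1 - y)) / y" using elim by (simp add: X_def add_divide_distrib)
        then show ?case using elim by (simp add: D_def K_def)
      qed
    qed (auto simp: X_def[abs_def])
    also have "\<dots> = M" using intK[OF t] m1 mt by simp
    finally show "Psi \<rho> (- complex_of_real t) = of_real (M - 1)"
      using \<rho>.Psi_eq[of "- complex_of_real t"] t by simp
  qed
qed

section \<open>The common domain of the S-transforms\<close>

lemma Psi_delta0: "Psi delta0 z = 0"
  by (simp add: Psi_def integral_return)

text \<open>By the identity theorem, an explicit candidate that inverts \<open>Psi\<close> on a real
  interval does so on all of \<open>D\<close>. Its values lie in the left half-plane, where
  \<open>Psi\<close> is injective, so it agrees with \<open>chi\<close>.\<close>

lemma (in nonneg_distribution) chi_eq_of_real_interval: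
  assumes D: "open D" "connected D" "0 < e" "complex_of_real ` {- e<..<0} \<subseteq> D"
    and f: "f holomorphic_on D" "f ` D \<subseteq> left_half_plane"
    and inv: "\<And>w. - e < w \<Longrightarrow> w < 0 \<Longrightarrow> Psi M (f (complex_of_real w)) = of_real w"
    and z: "z \<in> D"
  shows "Psi M (f z) = z" "chi M z = f z"
proof -
  define U where "U = complex_of_real ` {- e<..<0}"
  have "(\<lambda>z. Psi M (f z) - z) holomorphic_on D"
    by (intro holomorphic_on_diff holomorphic_on_compose_gen[OF f(1) Psi_holomorphic f(2), unfolded o_def]
        holomorphic_on_ident)
  then have "Psi M (f z) - z = 0"
  proof (rule analytic_continuation[OF _ D(1,2)])
    show "U \<subseteq> D" using D(4) by (simp add: U_def)
    show "complex_of_real (- e / 2) \<in> D" using D(3,4) by (auto simp del: of_real_divide of_real_minus)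
    show "complex_of_real (- e / 2) islimpt U"
      unfolding islimpt_approachable
    proof safe
      fix d :: real assume d: "0 < d"
      define x where "x = - e / 2 + min (d / 2) (e / 4)"
      have x: "- e / 2 < x" "x < - e / 2 + d" "x \<le> - e / 4" using d D(3) by (auto simp: x_def min_def)
      then have "complex_of_real x \<in> U" using D(3) by (auto simp: U_def)
      moreover have "dist (complex_of_real x) (complex_of_real (- e / 2)) < d"
        using x by (simp add: dist_of_real dist_real_def del: of_real_divide of_real_minus)
      moreover have "complex_of_real x \<noteq> complex_of_real (- e / 2)"
        using x by (simp del: of_real_divide of_real_minus)
      ultimately show "\<exists>x'\<in>U. x' \<noteq> complex_of_real (- e / 2) \<and> dist x' (complex_of_real (- e / 2)) < d"
        by blast
    qed
    show "Psi M (f z) - z = 0" if "z \<in> U" for z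
      using that inv by (auto simp: U_def)
  qed (rule z)
  then show Psi: "Psi M (f z) = z" by simp
  have "M \<noteq> delta0"
  proof
    assume "M = delta0"
    then show False using inv[of "- e / 2"] D(3) by (simp add: Psi_delta0)
  qed
  moreover have "f z \<in> left_half_plane" using f(2) z by auto
  ultimately have "chi M (Psi M (f z)) = f z"
    unfolding chi_def by (intro inv_into_f_f Psi_inj_on)
  then show "chi M z = f z" by (simp add: Psi)
qed

lemma S_transform_free_poisson_sqrt:
  assumes c: "1 \<le> c" and \<rho>: "nonneg_distribution \<rho>"
    and Psi_\<rho>: "\<And>t M. 0 < t \<Longrightarrow> 0 < M \<Longrightarrow> M * (1 + t * sqrt (c - 1 + M)) = 1
      \<Longrightarrow> Psi \<rho> (- complex_of_real t) = of_real (M - 1)"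
  obtains D where "open D" "connected D" "complex_of_real ` {- (1/2)<..<0} \<subseteq> D"
    "D \<subseteq> Psi \<rho> ` left_half_plane" "D \<subseteq> Psi (free_poisson c) ` left_half_plane"
    "\<And>z :: complex. z \<in> D \<Longrightarrow> z \<noteq> 0 \<and> 0 < Re (complex_of_real c + z) \<and> 0 < Re (1 + z)"
    "\<And>z :: complex. z \<in> D \<Longrightarrow> S_transform \<rho> z = 1 / csqrt (complex_of_real c + z)"
    "\<And>z :: complex. z \<in> D \<Longrightarrow> S_transform (free_poisson c) z = 1 / (complex_of_real c + z)"
proof -
  interpret \<rho>: nonneg_distribution \<rho> by (rule \<rho>)
  interpret \<sigma>: nonneg_distribution "free_poisson c" by (rule nonneg_distribution_free_poisson[OF c])
  \<comment> \<open>The candidates for \<open>chi\<close> are the prescribed S-transforms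
    \<open>1 / csqrt (c + w)\<close> and \<open>1 / (c + w)\<close> multiplied by
    \<open>w / (1 + w)\<close>.\<close>
  define f where "f w = w / ((1 + w) * csqrt (complex_of_real c + w))" for w :: complex
  define g where "g w = w / ((1 + w) * (complex_of_real c + w))" for w :: complex
  \<comment> \<open>Radius 1/2 keeps \<open>1 + w\<close> and \<open>c + w\<close> in the right
    half-plane, away from zeros and from the cut of the root.\<close>
  define B where "B = ball (0::complex) (1/2)"
  have B: "0 < Re (1 + w)" "0 < Re (complex_of_real c + w)" if "w \<in> B" for w :: complex
  proof -
    have "\<bar>Re w\<bar> < 1/2" using that abs_Re_le_cmod[of w] by (simp add: B_def)
    then show "0 < Re (1 + w)" "0 < Re (complex_of_real c + w)" using c by auto
  qed
  have nz: "1 + w \<noteq> 0" "complex_of_real c + w \<noteq> 0" if "w \<in> B" for w :: complex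
    using B[OF that] by (metis less_irrefl zero_complex.simps(1))+
  have notin: "complex_of_real c + w \<notin> \<real>\<^sub>\<le>\<^sub>0" if "w \<in> B" for w :: complex
    using B[OF that] by (auto simp: complex_nonpos_Reals_iff)
  have fB: "f holomorphic_on B"
    unfolding f_def[abs_def] using nz notin by (intro holomorphic_intros) auto
  have gB: "g holomorphic_on B"
    unfolding g_def[abs_def] using nz by (intro holomorphic_intros) auto
  define D0 where "D0 = (B \<inter> f -` left_half_plane) \<inter> (B \<inter> g -` left_half_plane)"
  have "open left_half_plane" unfolding left_half_plane_def by (rule open_halfspace_Re_lt)
  then have "open D0"
    unfolding D0_def using fB gB
    by (intro open_Int[OF continuous_open_preimage continuous_open_preimage])
       (auto simp: B_def holomorphic_on_imp_continuous_on)
  \<comment> \<open>The preimage \<open>D0\<close> may be disconnected, while the identity theorem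
    needs connectedness; the component is chosen by a point of the real interval.\<close>
  define D where "D = connected_component_set D0 (of_real (- (1/4)))"
  have f_real: "f (of_real w) = - of_real (- w / ((1 + w) * sqrt (c + w)))"
    and g_real: "g (of_real w) = of_real (w / ((1 + w) * (c + w)))"
    if "- (1/2) < w" "w < 0" for w :: real
  proof -
    have "csqrt (complex_of_real c + of_real w) = of_real (sqrt (c + w))"
      using that c by (simp flip: of_real_add)
    then show "f (of_real w) = - of_real (- w / ((1 + w) * sqrt (c + w)))" by (simp add: f_def)
    show "g (of_real w) = of_real (w / ((1 + w) * (c + w)))" by (simp add: g_def)
  qed
  have t_pos: "0 < - w / ((1 + w) * sqrt (c + w))" "w / ((1 + w) * (c + w)) < 0"
    if "- (1/2) < w" "w < 0" for w :: real
    using that c by (auto intro!: divide_pos_pos divide_neg_pos mult_pos_pos)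
  define J where "J = complex_of_real ` {- (1/2)<..<0}"
  have "J \<subseteq> D0"
  proof
    fix z assume "z \<in> J"
    then obtain w where w: "- (1/2) < w" "w < 0" "z = of_real w" by (auto simp: J_def)
    then have "z \<in> B" by (simp add: B_def)
    moreover have "Re (f z) < 0" "Re (g z) < 0"
      using t_pos[OF w(1,2)] unfolding w(3) f_real[OF w(1,2)] g_real[OF w(1,2)]
      by (simp_all only: uminus_complex.sel Re_complex_of_real neg_less_0_iff_less)
    ultimately show "z \<in> D0" by (simp add: D0_def left_half_plane_def)
  qed
  moreover have "connected J"
    unfolding J_def
    by (rule connected_continuous_image[OF continuous_on_of_real[OF continuous_on_id] connected_Ioo])
  moreover have "of_real (- (1/4)) \<in> J" unfolding J_def by (intro imageI) auto
  ultimately have JD: "J \<subseteq> D" unfolding D_def by (intro connected_component_maximal)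
  have D: "open D" "connected D" "D \<subseteq> D0"
    unfolding D_def using \<open>open D0\<close>
    by (simp_all only: open_connected_component connected_connected_component connected_component_subset)
  have DB: "D \<subseteq> B" using D(3) by (auto simp: D0_def)
  have fD: "f ` D \<subseteq> left_half_plane" "f holomorphic_on D" and gD: "g ` D \<subseteq> left_half_plane" "g holomorphic_on D"
    using D(3) fB gB DB by (auto simp: D0_def intro: holomorphic_on_subset)
  have inv_f: "Psi \<rho> (f (of_real w)) = of_real w" if w: "- (1/2) < w" "w < 0" for w :: real
  proof -
    define t where "t = - w / ((1 + w) * sqrt (c + w))"
    have t: "0 < t" using t_pos[OF w] by (simp add: t_def)
    \<comment> \<open>This is the fixed-point equation with \<open>M = 1 + w\<close>, solved for
      \<open>t\<close>.\<close>
    have "(1 + w) * (t * sqrt (c + w)) = - w" using w c by (simp add: t_def)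
    then have "(1 + w) * (1 + t * sqrt (c - 1 + (1 + w))) = 1" by (simp add: distrib_left)
    from Psi_\<rho>[OF t _ this] w show ?thesis
      unfolding f_real[OF w] by (simp add: t_def)
  qed
  have inv_g: "Psi (free_poisson c) (g (of_real w)) = of_real w" if w: "- (1/2) < w" "w < 0" for w :: real
    unfolding g_real[OF w] using Psi_free_poisson_inverse[OF c] w by simp
  have half: "0 < (1/2::real)" by simp
  have f_inv: "Psi \<rho> (f z) = z" "chi \<rho> z = f z" if "z \<in> D" for z
    by (rule \<rho>.chi_eq_of_real_interval[OF D(1,2) half JD[unfolded J_def] fD(2,1) _ that]; rule inv_f; assumption)+
  have g_inv: "Psi (free_poisson c) (g z) = z" "chi (free_poisson c) z = g z" if "z \<in> D" for z
    by (rule \<sigma>.chi_eq_of_real_interval[OF D(1,2) half JD[unfolded J_def] gD(2,1) _ that]; rule inv_g; assumption)+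
  have z_nz: "z \<noteq> 0" if "z \<in> D" for z
  proof
    assume "z = 0"
    then have "f z = 0" by (simp add: f_def)
    then show False using fD(1) that by (force simp: left_half_plane_def)
  qed
  show thesis
  proof (rule that[OF D(1,2) JD[unfolded J_def]])
    show "D \<subseteq> Psi \<rho> ` left_half_plane"
      using f_inv(1) fD(1) by (metis image_eqI image_subset_iff subsetI)
    show "D \<subseteq> Psi (free_poisson c) ` left_half_plane"
      using g_inv(1) gD(1) by (metis image_eqI image_subset_iff subsetI)
    fix z assume z: "z \<in> D"
    show "z \<noteq> 0 \<and> 0 < Re (complex_of_real c + z) \<and> 0 < Re (1 + z)"
      using z_nz z B DB by auto
    show "S_transform \<rho> z = 1 / csqrt (complex_of_real c + z)"
      using z_nz[OF z] nz z DB unfolding S_transform_def f_inv(2)[OF z] f_def by auto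
    show "S_transform (free_poisson c) z = 1 / (complex_of_real c + z)"
      using z_nz[OF z] nz z DB unfolding S_transform_def g_inv(2)[OF z] g_def by auto
  qed
qed

theorem proposition9:
  fixes c :: real
  assumes "c \<ge> 1"
  shows "free_mult_2_divisible (free_poisson c)"
proof -
  obtain \<rho> where \<rho>: "nonneg_distribution \<rho>"
    and Psi_\<rho>: "\<And>t M. 0 < t \<Longrightarrow> 0 < M \<Longrightarrow> M * (1 + t * sqrt (c - 1 + M)) = 1
      \<Longrightarrow> Psi \<rho> (- complex_of_real t) = of_real (M - 1)"
    using ex_sqrt_distribution[OF assms] by blast
  have fp: "nonneg_distribution (free_poisson c)"
    by (rule nonneg_distribution_free_poisson[OF assms])
  obtain D where D: "open D" "connected D" "complex_of_real ` {- (1/2)<..<0} \<subseteq> D"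
    "D \<subseteq> Psi \<rho> ` left_half_plane" "D \<subseteq> Psi (free_poisson c) ` left_half_plane"
    and nz: "\<And>z :: complex. z \<in> D \<Longrightarrow> z \<noteq> 0 \<and> 0 < Re (complex_of_real c + z) \<and> 0 < Re (1 + z)"
    and S\<rho>: "\<And>z :: complex. z \<in> D \<Longrightarrow> S_transform \<rho> z = 1 / csqrt (complex_of_real c + z)"
    and Sfp: "\<And>z :: complex. z \<in> D \<Longrightarrow> S_transform (free_poisson c) z = 1 / (complex_of_real c + z)"
    using S_transform_free_poisson_sqrt[OF assms \<rho> Psi_\<rho>] by blast
  have square: "1 / csqrt (complex_of_real c + z) * (1 / csqrt (complex_of_real c + z)) = 1 / (complex_of_real c + z)" for z :: complex
    using power2_csqrt[of "complex_of_real c + z"] by (simp add: power2_eq_square)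
  have S_mult: "S_multiplicative \<rho> \<rho> (free_poisson c)"
    unfolding S_multiplicative_def
    using D S\<rho> Sfp square by (intro exI[of _ D] conjI exI[of _ "1/2"]) auto
  have "\<rho> \<noteq> delta0"
  proof
    assume "\<rho> = delta0"
    moreover have "complex_of_real (- (1/4)) \<in> D" using D(3) by (auto simp del: of_real_minus of_real_divide)
    ultimately have "complex_of_real (- (1/4)) = 0" using D(4) Psi_delta0 by fastforce
    then show False by simp
  qed
  moreover have "(THE \<sigma>. \<sigma> \<in> pos_prob_measures \<and> S_multiplicative \<rho> \<rho> \<sigma>) = free_poisson c"
  proof (rule the_equality)
    show "free_poisson c \<in> pos_prob_measures \<and> S_multiplicative \<rho> \<rho> (free_poisson c)"
      using fp S_mult by (simp add: nonneg_distribution_iff)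
    fix \<sigma> assume \<sigma>: "\<sigma> \<in> pos_prob_measures \<and> S_multiplicative \<rho> \<rho> \<sigma>"
    then have "S_multiplicative \<rho> \<rho> \<sigma>" by simp
    then obtain D' where D'_all: "open D' \<and> connected D' \<and>
        D' \<subseteq> Psi \<rho> ` left_half_plane \<inter> Psi \<rho> ` left_half_plane \<inter> Psi \<sigma> ` left_half_plane \<and>
        (\<exists>\<epsilon>>0. complex_of_real ` {-\<epsilon><..<0} \<subseteq> D') \<and>
        (\<forall>z\<in>D'. S_transform \<sigma> z = S_transform \<rho> z * S_transform \<rho> z)"
      unfolding S_multiplicative_def by (elim exE)
    then obtain e where e: "0 < e" "complex_of_real ` {- e<..<0} \<subseteq> D'" by (elim conjE exE)
    have D': "D' \<subseteq> Psi \<sigma> ` left_half_plane" "0 < e" "complex_of_real ` {- e<..<0} \<subseteq> D'"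
      and S\<sigma>: "\<And>z. z \<in> D' \<Longrightarrow> S_transform \<sigma> z = S_transform \<rho> z * S_transform \<rho> z"
      using D'_all e by simp_all
    \<comment> \<open>The domain \<open>D'\<close> of an arbitrary competitor may differ from
      \<open>D\<close>; the comparison uses only a real interval contained in both.\<close>
    define d where "d = min e (1/2)"
    have d: "0 < d" "d \<le> e" "d \<le> 1/2" using D'(2) by (auto simp: d_def)
    define T where "T w = - w / ((1 + w) * (c + w))" for w :: real
    have Psi_T: "Psi \<sigma> (- complex_of_real (T w)) = of_real w" "Psi (free_poisson c) (- complex_of_real (T w)) = of_real w"
      "0 < T w" if w: "- d < w" "w < 0" for w
    proof -
      have wD: "complex_of_real w \<in> D" "complex_of_real w \<in> D'"
        using D(3) D'(3) d w by auto
      have nz': "1 + complex_of_real w \<noteq> 0" "complex_of_real c + complex_of_real w \<noteq> 0" "complex_of_real w \<noteq> 0"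
        using nz[OF wD(1)] by (auto simp: complex_eq_iff)
      have "S_transform \<sigma> (of_real w) = 1 / (complex_of_real c + of_real w)"
        using S\<sigma>[OF wD(2)] S\<rho>[OF wD(1)] square by simp
      then have "chi \<sigma> (of_real w) * ((1 + of_real w) * (complex_of_real c + of_real w)) = of_real w"
        unfolding S_transform_def using nz' by (simp add: field_simps)
      then have "chi \<sigma> (of_real w) = of_real w / ((1 + of_real w) * (complex_of_real c + of_real w))"
        using nz' by (simp add: eq_divide_eq)
      also have "\<dots> = - complex_of_real (T w)" by (simp add: T_def)
      finally have chi: "chi \<sigma> (of_real w) = - complex_of_real (T w)" .
      \<comment> \<open>As a choice of preimages, \<open>chi\<close> is a right inverse of
        \<open>Psi\<close> on the range, and the range contains \<open>D'\<close>.\<close>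
      have "Psi \<sigma> (chi \<sigma> (of_real w)) = of_real w"
        unfolding chi_def using D'(1) wD(2) by (intro f_inv_into_f) auto
      then show "Psi \<sigma> (- complex_of_real (T w)) = of_real w" by (simp add: chi)
      have "of_real (w / ((1 + w) * (c + w))) = - complex_of_real (T w)" by (simp add: T_def)
      then show "Psi (free_poisson c) (- complex_of_real (T w)) = of_real w"
        using Psi_free_poisson_inverse[OF assms, of w] w d by simp
      show "0 < T w" unfolding T_def using w d assms by (intro divide_pos_pos mult_pos_pos) auto
    qed
    \<comment> \<open>On this compact part of the interval \<open>T\<close> is continuous, and it
      takes distinct values at the ends because \<open>Psi\<close> recovers \<open>w\<close> from
      \<open>T w\<close>. Its image thus contains an interval of positive \<open>t\<close> on which
      the two transforms agree.\<close>
    define I where "I = {- (2 * d / 3).. - (d / 3)}"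
    have I: "- d < w \<and> w < 0" if "w \<in> I" for w using that d by (auto simp: I_def)
    have "continuous_on I T"
      unfolding T_def using I d assms by (intro continuous_intros) fastforce
    then have conn: "connected (T ` I)"
      by (rule connected_continuous_image) (simp only: I_def connected_Icc)
    define w1 w2 where "w1 = - (2 * d / 3)" and "w2 = - (d / 3)"
    have w12: "w1 \<in> I" "w2 \<in> I" "w1 \<noteq> w2" using d by (auto simp: w1_def w2_def I_def)
    have "T w1 \<noteq> T w2"
      using Psi_T(1) I w12 by (metis of_real_eq_iff)
    then obtain t1 t2 where t12: "t1 < t2" "t1 \<in> T ` I" "t2 \<in> T ` I"
      using w12 by (metis imageI linorder_neqE_linordered_idom)
    then have sub: "{t1..t2} \<subseteq> T ` I"
      using conn by (intro connected_contains_Icc)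
    have "0 < t1" using t12(2) Psi_T(3) I by auto
    then show "\<sigma> = free_poisson c"
    proof (rule nonneg_distribution_eqI[rotated 2])
      show "nonneg_distribution \<sigma>" using \<sigma> by (simp add: nonneg_distribution_iff)
      show "nonneg_distribution (free_poisson c)" by (rule fp)
      show "t1 < t2" by (rule t12(1))
      fix t assume "t1 < t" "t < t2"
      then have "t \<in> T ` I" using sub by (auto simp: subset_iff)
      then show "Psi \<sigma> (- complex_of_real t) = Psi (free_poisson c) (- complex_of_real t)"
        using Psi_T I by auto
    qed
  qed
  ultimately have "\<rho> \<boxtimes> \<rho> = free_poisson c" by (simp add: free_mult_conv_def)
  then show ?thesis
    unfolding free_mult_2_divisible_def using fp \<rho> by (metis nonneg_distribution_iff)
qed

end
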